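(* Let $A^*$ and $B^*$ be any infinite sets over which equality is decidable. Given a program $P$, a boolean variable $b_0$ of $P$, and a closed $\mu$-calculus formula $\varphi$ over the boolean variables of $P$, the problem whether $[\![P]\!]^*_{A^*,B^*}, b_0\models\varphi$ is decidable. Moreover, the answer is independent of which infinite sets $A^*$ and $B^*$ are used.
   Context: Transition systems are $(Q,\delta,[\![\cdot]\!],\mathcal{O})$: state space $Q$, successor function $\delta:Q\to 2^Q$, finite observables $\mathcal{O}$, extensions $[\![\cdot]\!]:\mathcal{O}\to 2^Q$. $\mu$-calculus: formulas $\varphi ::= p\mid\overline{p}\mid h\mid\varphi\vee\varphi\mid\varphi\wedge\varphi\mid\exists\bigcirc\varphi\mid\forall\bigcirc\varphi\mid(\mu h:\varphi)\mid(\nu h:\varphi)$ for observables $p$ and variables $h$. Given an environment $\mathcal{E}$ mapping variables to sets of states: $[\![p]\!]_\mathcal{E}=[\![p]\!]$, $[\![\overline{p}]\!]_\mathcal{E}=Q\setminus[\![p]\!]$, $[\![h]\!]_\mathcal{E}=\mathcal{E}(h)$, $\vee,\wedge$ are union and intersection, $[\![\exists\bigcirc\varphi]\!]_\mathcal{E}=\{s:\exists s'\in\delta(s),\ s'\in[\![\varphi]\!]_\mathcal{E}\}$, $[\![\forall\bigcirc\varphi]\!]_\mathcal{E}=\{s:\forall s'\in\delta(s),\ s'\in[\![\varphi]\!]_\mathcal{E}\}$, $[\![\mu h:\varphi]\!]_\mathcal{E}$ (resp. $\nu$) is the intersection (resp. union) of all $\tau\subseteq Q$ with $\tau=[\![\varphi]\!]_{\mathcal{E}[h\mapsto\tau]}$.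 For closed $\varphi$, $\mathcal{S},s\models\varphi$ means $s\in[\![\varphi]\!]_\mathcal{E}$ (for any $\mathcal{E}$), and for a boolean variable $b_0$, $\mathcal{S},b_0\models\varphi$ means $\mathcal{S},s\models\varphi$ for all $s\in[\![b_0]\!]$. Programs. Fix type symbols $X,Y$. A program $P$ has finitely many typed variables (boolean variables, $X$-variables, $Y$-variables, array variables indexed by $X$ storing $Y$) and finitely many guarded commands $e\longrightarrow I$, with boolean expressions $e ::= \mathbf{true}\mid\mathbf{false}\mid b\mid z=z'\mid\neg e\mid e\vee e$ ($z,z'$ data variables of the same type). A command $I$ contains for each boolean $b$ at most one $b:=e$; for each data variable $z$ at most one of $z:=z'$, $z:=\,?$ (nondeterministic choice), or (for $z$ of type $Y$) a read $z:=a[x]$; for each array $a$ at most one write $a[x]:=y$. $E_s(e)$ is the usual evaluation of $e$ in state $s$. Partial-functions semantics $[\![P]\!]^*_{A^*,B^*}$ (for infinite $A^*$ instantiating $X$, $B^*$ instantiating $Y$): states map booleans to truth values, $X$-variables into $A^*$, $Y$-variables into $B^*$, and each array $a$ to a partial function $s(a)$ from $A^*$ to $B^*$ with finite domain that is defined at $s(x)$ for all $X$-variables $x$ ($\bot$ denotes undefined; $\bot=\bot$, $\bot\ne w$ for values $w$). $s'\in\delta(s)$ iff some guarded command $e\longrightarrow I$ has $E_s(e)=\mathbf{true}$ and $s\,\Delta^*_I\,s'$, where $s\,\Delta^*_I\,s'$ iff (i) $s'(b)=E_s(e)$ if $b:=e\in I$, else $s'(b)=s(b)$; (ii) for data variables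 $z$: if $z:=z'\in I$ then $s'(z)=s(z')$, else if $z:=a[x]\in I$ then $s'(z)=s(a)(s(x))$, else either $z:=\,?\in I$ or $s'(z)=s(z)$; (iii) for each array $a$ and $v\in A^*$: if $a[x]:=y\in I$ with $s(x)=v$ then $s'(a)(v)=s(y)$; otherwise, if there is no $X$-variable $x$ with $x:=\,?\in I$, $s'(x)=v$ and $s(a)(v)=\bot$, then $s'(a)(v)=s(a)(v)$. Observables are the boolean variables with $[\![b]\!]=\{s:s(b)=\mathbf{true}\}$. *)

theory Defs
  imports Main "HOL-Library.FuncSet" "HOL-Library.Nat_Bijection"
begin

section \<open>Decidability\<close>

text \<open>
  Total recursive functions of arity \<open>n\<close>, as functions on argument lists of length \<open>n\<close>; values
  on lists of any other length carry no meaning.  Minimisation is restricted to regular functions,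
  so the class contains exactly the total recursive functions.
\<close>

inductive recursive :: "nat \<Rightarrow> (nat list \<Rightarrow> nat) \<Rightarrow> bool" where
  zero: "recursive n (\<lambda>_. 0)"
| succ: "recursive 1 (\<lambda>xs. Suc (xs ! 0))"
| proj: "i < n \<Longrightarrow> recursive n (\<lambda>xs. xs ! i)"
| comp: "recursive (length gs) f \<Longrightarrow> (\<And>g. g \<in> set gs \<Longrightarrow> recursive n g) \<Longrightarrow>
    recursive n (\<lambda>xs. f (map (\<lambda>g. g xs) gs))"
| prec: "recursive n f \<Longrightarrow> recursive (Suc (Suc n)) g \<Longrightarrow>
    recursive (Suc n) (\<lambda>xs. rec_nat (f (tl xs)) (\<lambda>k r. g (k # r # tl xs)) (hd xs))"
| mini: "recursive (Suc n) f \<Longrightarrow> (\<And>xs. length xs = n \<Longrightarrow> \<exists>k. f (k # xs) = 0) \<Longrightarrow>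
    recursive n (\<lambda>xs. LEAST k. f (k # xs) = 0)"

definition decidable_on :: "('i \<Rightarrow> nat) \<Rightarrow> 'i set \<Rightarrow> ('i \<Rightarrow> bool) \<Rightarrow> bool" where
  "decidable_on code I R \<longleftrightarrow>
    (\<exists>f. recursive 1 f \<and> (\<forall>i\<in>I. f [code i] = (if R i then 1 else 0)))"


section \<open>Transition systems and the \<open>\<mu>\<close>-calculus\<close>

record ('s, 'o) transition_system =
  states :: "'s set"
  succs :: "'s \<Rightarrow> 's set"
  observables :: "'o set"
  ext :: "'o \<Rightarrow> 's set"

datatype ('o, 'h) mu_formula =
    Obs 'o
  | NegObs 'o
  | FVar 'h
  | Or "('o, 'h) mu_formula" "('o, 'h) mu_formula"
  | And "('o, 'h) mu_formula" "('o, 'h) mu_formula"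
  | ExNext "('o, 'h) mu_formula"
  | AllNext "('o, 'h) mu_formula"
  | Mu 'h "('o, 'h) mu_formula"
  | Nu 'h "('o, 'h) mu_formula"

primrec free_vars :: "('o, 'h) mu_formula \<Rightarrow> 'h set" where
  "free_vars (Obs p) = {}"
| "free_vars (NegObs p) = {}"
| "free_vars (FVar h) = {h}"
| "free_vars (Or \<phi> \<psi>) = free_vars \<phi> \<union> free_vars \<psi>"
| "free_vars (And \<phi> \<psi>) = free_vars \<phi> \<union> free_vars \<psi>"
| "free_vars (ExNext \<phi>) = free_vars \<phi>"
| "free_vars (AllNext \<phi>) = free_vars \<phi>"
| "free_vars (Mu h \<phi>) = free_vars \<phi> - {h}"
| "free_vars (Nu h \<phi>) = free_vars \<phi> - {h}"

definition closed_formula :: "('o, 'h) mu_formula \<Rightarrow> bool" where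
  "closed_formula \<phi> \<longleftrightarrow> free_vars \<phi> = {}"

primrec formula_obs :: "('o, 'h) mu_formula \<Rightarrow> 'o set" where
  "formula_obs (Obs p) = {p}"
| "formula_obs (NegObs p) = {p}"
| "formula_obs (FVar h) = {}"
| "formula_obs (Or \<phi> \<psi>) = formula_obs \<phi> \<union> formula_obs \<psi>"
| "formula_obs (And \<phi> \<psi>) = formula_obs \<phi> \<union> formula_obs \<psi>"
| "formula_obs (ExNext \<phi>) = formula_obs \<phi>"
| "formula_obs (AllNext \<phi>) = formula_obs \<phi>"
| "formula_obs (Mu h \<phi>) = formula_obs \<phi>"
| "formula_obs (Nu h \<phi>) = formula_obs \<phi>"

primrec mu_sem ::
  "('s, 'o) transition_system \<Rightarrow> ('o, 'h) mu_formula \<Rightarrow> ('h \<Rightarrow> 's set) \<Rightarrow> 's set" where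
  "mu_sem S (Obs p) E = ext S p"
| "mu_sem S (NegObs p) E = states S - ext S p"
| "mu_sem S (FVar h) E = E h"
| "mu_sem S (Or \<phi> \<psi>) E = mu_sem S \<phi> E \<union> mu_sem S \<psi> E"
| "mu_sem S (And \<phi> \<psi>) E = mu_sem S \<phi> E \<inter> mu_sem S \<psi> E"
| "mu_sem S (ExNext \<phi>) E = {s \<in> states S. \<exists>s'\<in>succs S s. s' \<in> mu_sem S \<phi> E}"
| "mu_sem S (AllNext \<phi>) E = {s \<in> states S. \<forall>s'\<in>succs S s. s' \<in> mu_sem S \<phi> E}"
| "mu_sem S (Mu h \<phi>) E = \<Inter>{\<tau>. \<tau> \<subseteq> states S \<and> \<tau> = mu_sem S \<phi> (E(h := \<tau>))}"
| "mu_sem S (Nu h \<phi>) E = \<Union>{\<tau>. \<tau> \<subseteq> states S \<and> \<tau> = mu_sem S \<phi> (E(h := \<tau>))}"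

definition sat :: "('s, 'o) transition_system \<Rightarrow> 's \<Rightarrow> ('o, 'h) mu_formula \<Rightarrow> bool" where
  "sat S s \<phi> \<longleftrightarrow> (\<forall>E. (\<forall>h. E h \<subseteq> states S) \<longrightarrow> s \<in> mu_sem S \<phi> E)"

definition sat_from :: "('s, 'o) transition_system \<Rightarrow> 'o \<Rightarrow> ('o, 'h) mu_formula \<Rightarrow> bool" where
  "sat_from S b \<phi> \<longleftrightarrow> (\<forall>s\<in>ext S b. sat S s \<phi>)"


section \<open>Programs\<close>

text \<open>
  Variables are named by natural numbers, with a separate name space for each of the four types,
  so the type of a variable is determined by the constructor in which it occurs.
\<close>

datatype bexp =
    BTrue
  | BFalse
  | BVar nat
  | EqX nat nat
  | EqY nat nat
  | BNot bexp
  | BOr bexp bexp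

datatype assignment =
    AssignB nat bexp
  | CopyX nat nat
  | CopyY nat nat
  | ChooseX nat
  | ChooseY nat
  | Read nat nat nat  \<comment> \<open>\<open>Read z a x\<close> is \<open>z := a[x]\<close>\<close>
  | Write nat nat nat \<comment> \<open>\<open>Write a x y\<close> is \<open>a[x] := y\<close>\<close>

datatype target = BoolT nat | XT nat | YT nat | ArrayT nat

primrec target_of :: "assignment \<Rightarrow> target" where
  "target_of (AssignB b e) = BoolT b"
| "target_of (CopyX z z') = XT z"
| "target_of (CopyY z z') = YT z"
| "target_of (ChooseX z) = XT z"
| "target_of (ChooseY z) = YT z"
| "target_of (Read z a x) = YT z"
| "target_of (Write a x y) = ArrayT a"

text \<open>Lists of variables, assignments and commands represent the finite sets of their elements.\<close>

record program =
  bool_vars :: "nat list"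
  x_vars :: "nat list"
  y_vars :: "nat list"
  arrays :: "nat list"
  commands :: "(bexp \<times> assignment list) list"

primrec wf_bexp :: "program \<Rightarrow> bexp \<Rightarrow> bool" where
  "wf_bexp P BTrue \<longleftrightarrow> True"
| "wf_bexp P BFalse \<longleftrightarrow> True"
| "wf_bexp P (BVar b) \<longleftrightarrow> b \<in> set (bool_vars P)"
| "wf_bexp P (EqX z z') \<longleftrightarrow> z \<in> set (x_vars P) \<and> z' \<in> set (x_vars P)"
| "wf_bexp P (EqY z z') \<longleftrightarrow> z \<in> set (y_vars P) \<and> z' \<in> set (y_vars P)"
| "wf_bexp P (BNot e) \<longleftrightarrow> wf_bexp P e"
| "wf_bexp P (BOr e e') \<longleftrightarrow> wf_bexp P e \<and> wf_bexp P e'"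

primrec wf_assignment :: "program \<Rightarrow> assignment \<Rightarrow> bool" where
  "wf_assignment P (AssignB b e) \<longleftrightarrow> b \<in> set (bool_vars P) \<and> wf_bexp P e"
| "wf_assignment P (CopyX z z') \<longleftrightarrow> z \<in> set (x_vars P) \<and> z' \<in> set (x_vars P)"
| "wf_assignment P (CopyY z z') \<longleftrightarrow> z \<in> set (y_vars P) \<and> z' \<in> set (y_vars P)"
| "wf_assignment P (ChooseX z) \<longleftrightarrow> z \<in> set (x_vars P)"
| "wf_assignment P (ChooseY z) \<longleftrightarrow> z \<in> set (y_vars P)"
| "wf_assignment P (Read z a x) \<longleftrightarrow>
    z \<in> set (y_vars P) \<and> a \<in> set (arrays P) \<and> x \<in> set (x_vars P)"
| "wf_assignment P (Write a x y) \<longleftrightarrow>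
    a \<in> set (arrays P) \<and> x \<in> set (x_vars P) \<and> y \<in> set (y_vars P)"

definition wf_program :: "program \<Rightarrow> bool" where
  "wf_program P \<longleftrightarrow>
    (\<forall>(e, I)\<in>set (commands P). wf_bexp P e \<and>
      (\<forall>i\<in>set I. wf_assignment P i) \<and>
      (\<forall>i\<in>set I. \<forall>j\<in>set I. target_of i = target_of j \<longrightarrow> i = j))"


section \<open>Partial-functions semantics\<close>

record ('a, 'b) state =
  bool_val :: "nat \<Rightarrow> bool"
  x_val :: "nat \<Rightarrow> 'a"
  y_val :: "nat \<Rightarrow> 'b"
  array_val :: "nat \<Rightarrow> 'a \<rightharpoonup> 'b"

text \<open>
  States are functions on the variables of the program only, hence the extensional function
  spaces.
\<close>

definition program_states :: "program \<Rightarrow> 'a set \<Rightarrow> 'b set \<Rightarrow> ('a, 'b) state set" where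
  "program_states P A B = {s.
    bool_val s \<in> set (bool_vars P) \<rightarrow>\<^sub>E UNIV \<and>
    x_val s \<in> set (x_vars P) \<rightarrow>\<^sub>E A \<and>
    y_val s \<in> set (y_vars P) \<rightarrow>\<^sub>E B \<and>
    array_val s \<in> set (arrays P) \<rightarrow>\<^sub>E
      {m. finite (dom m) \<and> dom m \<subseteq> A \<and> ran m \<subseteq> B \<and> (\<forall>x\<in>set (x_vars P). x_val s x \<in> dom m)}}"

primrec beval :: "('a, 'b) state \<Rightarrow> bexp \<Rightarrow> bool" where
  "beval s BTrue \<longleftrightarrow> True"
| "beval s BFalse \<longleftrightarrow> False"
| "beval s (BVar b) \<longleftrightarrow> bool_val s b"
| "beval s (EqX z z') \<longleftrightarrow> x_val s z = x_val s z'"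
| "beval s (EqY z z') \<longleftrightarrow> y_val s z = y_val s z'"
| "beval s (BNot e) \<longleftrightarrow> \<not> beval s e"
| "beval s (BOr e e') \<longleftrightarrow> beval s e \<or> beval s e'"

definition step_bool ::
  "program \<Rightarrow> assignment set \<Rightarrow> ('a, 'b) state \<Rightarrow> ('a, 'b) state \<Rightarrow> bool" where
  "step_bool P I s s' \<longleftrightarrow> (\<forall>b\<in>set (bool_vars P).
    (\<forall>e. AssignB b e \<in> I \<longrightarrow> bool_val s' b = beval s e) \<and>
    ((\<nexists>e. AssignB b e \<in> I) \<longrightarrow> bool_val s' b = bool_val s b))"

definition step_x ::
  "program \<Rightarrow> assignment set \<Rightarrow> ('a, 'b) state \<Rightarrow> ('a, 'b) state \<Rightarrow> bool" where
  "step_x P I s s' \<longleftrightarrow> (\<forall>z\<in>set (x_vars P).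
    (\<forall>z'. CopyX z z' \<in> I \<longrightarrow> x_val s' z = x_val s z') \<and>
    ((\<nexists>z'. CopyX z z' \<in> I) \<longrightarrow> ChooseX z \<in> I \<or> x_val s' z = x_val s z))"

definition step_y ::
  "program \<Rightarrow> assignment set \<Rightarrow> ('a, 'b) state \<Rightarrow> ('a, 'b) state \<Rightarrow> bool" where
  "step_y P I s s' \<longleftrightarrow> (\<forall>z\<in>set (y_vars P).
    (\<forall>z'. CopyY z z' \<in> I \<longrightarrow> y_val s' z = y_val s z') \<and>
    (\<forall>a x. Read z a x \<in> I \<longrightarrow> Some (y_val s' z) = array_val s a (x_val s x)) \<and>
    ((\<nexists>z'. CopyY z z' \<in> I) \<and> (\<nexists>a x. Read z a x \<in> I) \<longrightarrow>
      ChooseY z \<in> I \<or> y_val s' z = y_val s z))"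

definition step_array ::
  "program \<Rightarrow> 'a set \<Rightarrow> assignment set \<Rightarrow> ('a, 'b) state \<Rightarrow> ('a, 'b) state \<Rightarrow> bool" where
  "step_array P A I s s' \<longleftrightarrow> (\<forall>a\<in>set (arrays P). \<forall>v\<in>A.
    (\<forall>x y. Write a x y \<in> I \<and> x_val s x = v \<longrightarrow> array_val s' a v = Some (y_val s y)) \<and>
    ((\<nexists>x y. Write a x y \<in> I \<and> x_val s x = v) \<longrightarrow>
      (\<nexists>x. x \<in> set (x_vars P) \<and> ChooseX x \<in> I \<and> x_val s' x = v \<and> array_val s a v = None) \<longrightarrow>
      array_val s' a v = array_val s a v))"

definition program_ts ::
  "program \<Rightarrow> 'a set \<Rightarrow> 'b set \<Rightarrow> (('a, 'b) state, nat) transition_system" where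
  "program_ts P A B = \<lparr>
    states = program_states P A B,
    succs = (\<lambda>s. {s' \<in> program_states P A B. \<exists>(e, I)\<in>set (commands P). beval s e \<and>
      step_bool P (set I) s s' \<and> step_x P (set I) s s' \<and>
      step_y P (set I) s s' \<and> step_array P A (set I) s s'}),
    observables = set (bool_vars P),
    ext = (\<lambda>b. {s \<in> program_states P A B. bool_val s b})\<rparr>"


section \<open>Instances of the model-checking problem and their codes\<close>

type_synonym mc_instance = "program \<times> nat \<times> (nat, nat) mu_formula"

definition mc_instances :: "mc_instance set" where
  "mc_instances = {(P, b\<^sub>0, \<phi>). wf_program P \<and> b\<^sub>0 \<in> set (bool_vars P) \<and>
    closed_formula \<phi> \<and> formula_obs \<phi> \<subseteq> set (bool_vars P)}"

text \<open>
  The carriers enter only through HOL equality, which is total; they need not be effectively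
  presented, and they are not part of an instance.
\<close>

definition mc_holds :: "'a set \<Rightarrow> 'b set \<Rightarrow> mc_instance \<Rightarrow> bool" where
  "mc_holds A B = (\<lambda>(P, b\<^sub>0, \<phi>). sat_from (program_ts P A B) b\<^sub>0 \<phi>)"

primrec bexp_code :: "bexp \<Rightarrow> nat" where
  "bexp_code BTrue = list_encode [0]"
| "bexp_code BFalse = list_encode [1]"
| "bexp_code (BVar b) = list_encode [2, b]"
| "bexp_code (EqX z z') = list_encode [3, z, z']"
| "bexp_code (EqY z z') = list_encode [4, z, z']"
| "bexp_code (BNot e) = list_encode [5, bexp_code e]"
| "bexp_code (BOr e e') = list_encode [6, bexp_code e, bexp_code e']"

primrec assignment_code :: "assignment \<Rightarrow> nat" where
  "assignment_code (AssignB b e) = list_encode [0, b, bexp_code e]"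
| "assignment_code (CopyX z z') = list_encode [1, z, z']"
| "assignment_code (CopyY z z') = list_encode [2, z, z']"
| "assignment_code (ChooseX z) = list_encode [3, z]"
| "assignment_code (ChooseY z) = list_encode [4, z]"
| "assignment_code (Read z a x) = list_encode [5, z, a, x]"
| "assignment_code (Write a x y) = list_encode [6, a, x, y]"

definition command_code :: "bexp \<times> assignment list \<Rightarrow> nat" where
  "command_code = (\<lambda>(e, I). list_encode [bexp_code e, list_encode (map assignment_code I)])"

definition program_code :: "program \<Rightarrow> nat" where
  "program_code P = list_encode
    [list_encode (bool_vars P), list_encode (x_vars P), list_encode (y_vars P),
     list_encode (arrays P), list_encode (map command_code (commands P))]"

primrec formula_code :: "(nat, nat) mu_formula \<Rightarrow> nat" where
  "formula_code (Obs p) = list_encode [0, p]"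
| "formula_code (NegObs p) = list_encode [1, p]"
| "formula_code (FVar h) = list_encode [2, h]"
| "formula_code (Or \<phi> \<psi>) = list_encode [3, formula_code \<phi>, formula_code \<psi>]"
| "formula_code (And \<phi> \<psi>) = list_encode [4, formula_code \<phi>, formula_code \<psi>]"
| "formula_code (ExNext \<phi>) = list_encode [5, formula_code \<phi>]"
| "formula_code (AllNext \<phi>) = list_encode [6, formula_code \<phi>]"
| "formula_code (Mu h \<phi>) = list_encode [7, h, formula_code \<phi>]"
| "formula_code (Nu h \<phi>) = list_encode [8, h, formula_code \<phi>]"

definition mc_code :: "mc_instance \<Rightarrow> nat" where
  "mc_code = (\<lambda>(P, b\<^sub>0, \<phi>). list_encode [program_code P, b\<^sub>0, formula_code \<phi>])"

lemma inj_bexp_code: "inj bexp_code"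
proof (rule injI)
  fix d
  have "\<forall>e'. bexp_code d = bexp_code e' \<longrightarrow> d = e'"
    by (induction d; intro allI; case_tac e'; simp del: list_encode.simps add: list_encode_eq)
  then show "d = d'" if "bexp_code d = bexp_code d'" for d'
    using that by blast
qed

lemma inj_assignment_code: "inj assignment_code"
proof (rule injI)
  show "i = j" if "assignment_code i = assignment_code j" for i j
    using that inj_bexp_code
    by (cases i; cases j) (simp_all del: list_encode.simps add: list_encode_eq inj_eq)
qed

lemma inj_command_code: "inj command_code"
  using inj_bexp_code inj_assignment_code
  by (auto intro!: injI simp del: list_encode.simps
      simp add: command_code_def list_encode_eq inj_eq inj_map_eq_map)

lemma inj_program_code: "inj program_code"
  using inj_command_code
  by (auto intro!: injI program.equality simp del: list_encode.simps
      simp add: program_code_def list_encode_eq inj_map_eq_map)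

lemma inj_formula_code: "inj formula_code"
proof (rule injI)
  fix \<phi>
  have "\<forall>\<psi>. formula_code \<phi> = formula_code \<psi> \<longrightarrow> \<phi> = \<psi>"
    by (induction \<phi>; intro allI; case_tac \<psi>; simp del: list_encode.simps add: list_encode_eq)
  then show "\<phi> = \<psi>'" if "formula_code \<phi> = formula_code \<psi>'" for \<psi>'
    using that by blast
qed

lemma inj_mc_code: "inj mc_code"
  using inj_program_code inj_formula_code
  by (auto intro!: injI simp del: list_encode.simps
      simp add: mc_code_def list_encode_eq inj_eq)

end

theory Submission
  imports Defs
begin

text \<open>
  Call the variables of type \<open>Y\<close> and the array entries \<open>a[x]\<close> the \<open>Y\<close>-terms of a program.  Two states
  with the same boolean values, the same equalities between \<open>X\<close>-variables and the same equalities
  between \<open>Y\<close>-terms satisfy the same formulas, even over different carriers: equality patterns form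
  a bisimulation.  The point is that arrays have finite domain, so \<open>x := ?\<close> can always hit a value
  at which every array is undefined, and there the new entries are arbitrary; hence entries outside
  the current values of the \<open>X\<close>-variables never have to be remembered.  There are finitely many
  patterns, which gives independence of the carriers and a finite symbolic system whose size is
  computable from the program.

  On the finite system, the fixpoint operators are evaluated by quantifying over all sets of
  states.  With sets coded as bit masks, every quantifier in the semantics becomes bounded, and
  the recursion over subformulas becomes an iteration of one decidable operation on a bit mask.
\<close>

section \<open>Computable functions and decidable predicates\<close>

text \<open>Matching steps alone does not carry fixpoints across. The semantics intersects or unites
  all fixpoints, so Knaster-Tarski first trades them for pre- and post-fixpoints; these move along
  the relation because it is difunctional, pairing blocks of states with blocks of states. A
  symbolic state is not a pattern but a small concrete state with values below \<open>L\<close> and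
  total arrays. Several codes for one pattern do no harm, since states are compared by similarity
  and not by equality. A step involves the values before and after it, so \<open>L\<close> has room
  for twice as many values as there are X-variables or Y-terms: new values are then matched without
  disturbing those already matched. All sizes come from the code of the instance, which exceeds
  every name, length and subterm code in it. Subformulas have smaller codes than the formula, so as
  many rounds as this code suffice. The resulting check mentions no carrier; one equivalence yields
  both decidability and independence.\<close>

text \<open>
  Argument lists act as environments: a bound variable is consed onto the list, so that the body of
  a binder refers to it by \<open>hd\<close> and to the outer variables through \<open>tl\<close>.
\<close>

definition computable :: "nat \<Rightarrow> (nat list \<Rightarrow> nat) \<Rightarrow> bool" where
  "computable n f \<longleftrightarrow> (\<exists>g. recursive n g \<and> (\<forall>xs. length xs = n \<longrightarrow> g xs = f xs))"

definition decidable :: "nat \<Rightarrow> (nat list \<Rightarrow> bool) \<Rightarrow> bool" where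
  "decidable n P \<longleftrightarrow> computable n (\<lambda>xs. if P xs then 1 else 0)"

named_theorems computable_intros

lemma computI: "recursive n g \<Longrightarrow> (\<And>xs. length xs = n \<Longrightarrow> g xs = f xs) \<Longrightarrow> computable n f"
  unfolding computable_def by blast

text \<open>\<open>recursive\<close> pins down a function on lists of every length; agreement on
  length \<open>n\<close> is the looser notion under which function bodies may be rewritten.\<close>

lemma computable_cong: "computable n f \<Longrightarrow> (\<And>xs. length xs = n \<Longrightarrow> f xs = g xs) \<Longrightarrow> computable n g"
  unfolding computable_def by metis

lemma decidable_cong: "decidable n f \<Longrightarrow> (\<And>xs. length xs = n \<Longrightarrow> f xs = g xs) \<Longrightarrow> decidable n g"
  unfolding decidable_def by (erule computable_cong) simp

section \<open>Composition, projections and weakening\<close>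

lemma computable_comp:
  assumes "computable (length gs) f" "\<And>g. g \<in> set gs \<Longrightarrow> computable n g"
  shows "computable n (\<lambda>xs. f (map (\<lambda>g. g xs) gs))"
proof -
  obtain f' where f': "recursive (length gs) f'" "\<And>xs. length xs = length gs \<Longrightarrow> f' xs = f xs"
    using assms(1) unfolding computable_def by blast
  obtain c where c: "\<And>g. g \<in> set gs \<Longrightarrow> recursive n (c g)"
    "\<And>g xs. g \<in> set gs \<Longrightarrow> length xs = n \<Longrightarrow> c g xs = g xs"
    using assms(2) unfolding computable_def by metis
  have "recursive n (\<lambda>xs. f' (map (\<lambda>g. g xs) (map c gs)))"
    using f'(1) c(1) by (intro recursive.comp) auto
  then show ?thesis
    by (rule computI) (simp add: f'(2) c(2) comp_def cong: map_cong)
qed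

lemma computable_nth: "i < n \<Longrightarrow> computable n (\<lambda>xs. xs ! i)"
  by (rule computI[OF recursive.proj]) simp_all

lemma computable_Suc_nth: "computable (Suc 0) (\<lambda>xs. Suc (xs ! 0))"
  using computI[OF recursive.succ] by simp

lemma computable_const: "computable n (\<lambda>_. k)"
proof (induction k)
  case 0
  show ?case by (rule computI[OF recursive.zero]) simp
next
  case (Suc k)
  have "computable n (\<lambda>xs. (\<lambda>xs. Suc (xs ! 0)) (map (\<lambda>g. g xs) [\<lambda>_. k]))"
    using Suc by (intro computable_comp) (auto intro: computable_Suc_nth)
  then show ?case by simp
qed

lemma computable_hd: "computable (Suc n) hd"
  by (rule computable_cong[OF computable_nth[of 0]]) (auto simp: length_Suc_conv)

text \<open>Weakening by one binder. \<open>tl\<close> is not a numeric function, so the tail is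
  reassembled from projections.\<close>

lemma computable_tl:
  assumes "computable n f" shows "computable (Suc n) (\<lambda>xs. f (tl xs))"
proof -
  have "computable (Suc n) (\<lambda>xs. f (map (\<lambda>g. g xs) (map (\<lambda>i xs. xs ! Suc i) [0..<n])))"
    using assms by (intro computable_comp) (auto intro: computable_nth)
  then show ?thesis
  proof (rule computable_cong)
    fix xs :: "nat list" assume "length xs = Suc n"
    then have "map (\<lambda>g. g xs) (map (\<lambda>i xs. xs ! Suc i) [0..<n]) = tl xs"
      by (intro nth_equalityI) (auto simp: nth_tl)
    then show "f (map (\<lambda>g. g xs) (map (\<lambda>i xs. xs ! Suc i) [0..<n])) = f (tl xs)" by simp
  qed
qed

lemma decidable_const: "decidable n (\<lambda>_. b)"
  unfolding decidable_def by (rule computable_const)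

lemmas computable_leaves = computable_hd computable_const decidable_const computable_tl

section \<open>Recursion, search, connectives and arithmetic\<close>

lemma computable_Suc [computable_intros]:
  assumes "computable n f" shows "computable n (\<lambda>xs. Suc (f xs))"
  using computable_comp[of "[f]" "\<lambda>xs. Suc (xs ! 0)" n] assms
  by (simp add: computable_Suc_nth)

lemma computable_rec [computable_intros]:
  assumes "computable n b" "computable n f"
    "computable (Suc (Suc n)) (\<lambda>xs. g (hd xs) (hd (tl xs)) (tl (tl xs)))"
  shows "computable n (\<lambda>xs. rec_nat (f xs) (\<lambda>k r. g k r xs) (b xs))"
proof -
  \<comment> \<open>Primitive recursion runs on its first argument, so the count becomes the head of
    the list; composition then substitutes \<open>b\<close> for it.\<close>
  let ?h = "\<lambda>xs. rec_nat (f (tl xs)) (\<lambda>k r. g k r (tl xs)) (hd xs)"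
  obtain f' where f': "recursive n f'" "\<And>xs. length xs = n \<Longrightarrow> f' xs = f xs"
    using assms(2) unfolding computable_def by blast
  obtain g' where g': "recursive (Suc (Suc n)) g'"
    "\<And>xs. length xs = Suc (Suc n) \<Longrightarrow> g' xs = g (hd xs) (hd (tl xs)) (tl (tl xs))"
    using assms(3) unfolding computable_def by blast
  have "computable (Suc n) ?h"
    by (rule computI[OF recursive.prec[OF f'(1) g'(1)]]) (simp add: f'(2) g'(2))
  then have "computable n (\<lambda>xs. ?h (map (\<lambda>g. g xs) (b # map (\<lambda>i xs. xs ! i) [0..<n])))"
    using assms(1) by (intro computable_comp) (auto intro: computable_nth)
  then show ?thesis
  proof (rule computable_cong)
    fix xs :: "nat list" assume "length xs = n"
    then have "map (\<lambda>g. g xs) (map (\<lambda>i xs. xs ! i) [0..<n]) = xs"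
      by (intro nth_equalityI) auto
    then show "?h (map (\<lambda>g. g xs) (b # map (\<lambda>i xs. xs ! i) [0..<n])) =
      rec_nat (f xs) (\<lambda>k r. g k r xs) (b xs)"
      by (simp del: map_map)
  qed
qed

lemma computable_if [computable_intros]:
  assumes "decidable n P" "computable n f" "computable n g"
  shows "computable n (\<lambda>xs. if P xs then f xs else g xs)"
proof -
  \<comment> \<open>A conditional is a recursion of length 1 or 0: one round returns
    \<open>f xs\<close>, none returns \<open>g xs\<close>.\<close>
  have "computable n (\<lambda>xs. rec_nat (g xs) (\<lambda>k r. f xs) (if P xs then 1 else 0))"
    using assms unfolding decidable_def by (intro computable_intros computable_leaves)
  then show ?thesis by (rule computable_cong) auto
qed

text \<open>Minimisation looks for a zero, hence truth is 0 and falsity 1 inside the proof. The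
  second assumption supplies the regularity demanded by \<open>mini\<close>.\<close>

lemma computable_Least [computable_intros]:
  assumes "decidable (Suc n) (\<lambda>xs. P (hd xs) (tl xs))" "\<And>xs. \<exists>k. P k xs"
  shows "computable n (\<lambda>xs. LEAST k. P k xs)"
proof -
  have "computable (Suc n) (\<lambda>xs. if P (hd xs) (tl xs) then 0 else 1)"
    using assms(1) by (intro computable_intros computable_leaves)
  then obtain f where f: "recursive (Suc n) f"
    "\<And>xs. length xs = Suc n \<Longrightarrow> f xs = (if P (hd xs) (tl xs) then 0 else 1)"
    unfolding computable_def by blast
  then have f': "f (k # xs) = 0 \<longleftrightarrow> P k xs" if "length xs = n" for k xs
    using that by simp
  have "recursive n (\<lambda>xs. LEAST k. f (k # xs) = 0)"
    by (rule recursive.mini[OF f(1)]) (simp add: f' assms(2))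
  then show ?thesis by (rule computI) (simp add: f')
qed

lemma decidable_not [computable_intros]: "decidable n P \<Longrightarrow> decidable n (\<lambda>xs. \<not> P xs)"
  unfolding decidable_def[of n "\<lambda>xs. \<not> P xs"]
  by (rule computable_cong[OF computable_if[OF _ computable_const[of n 0] computable_const[of n 1]]]) auto

lemma decidable_and [computable_intros]:
  assumes "decidable n P" "decidable n Q" shows "decidable n (\<lambda>xs. P xs \<and> Q xs)"
proof -
  have "computable n (\<lambda>xs. if P xs then (if Q xs then 1 else 0) else 0)"
    using assms by (intro computable_intros computable_leaves)
  then show ?thesis unfolding decidable_def by (rule computable_cong) simp
qed

lemma decidable_or [computable_intros]:
  assumes "decidable n P" "decidable n Q" shows "decidable n (\<lambda>xs. P xs \<or> Q xs)"
proof -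
  have "decidable n (\<lambda>xs. \<not> (\<not> P xs \<and> \<not> Q xs))"
    using assms by (intro computable_intros computable_leaves)
  then show ?thesis by simp
qed

lemma decidable_imp [computable_intros]:
  assumes "decidable n P" "decidable n Q" shows "decidable n (\<lambda>xs. P xs \<longrightarrow> Q xs)"
proof -
  have "decidable n (\<lambda>xs. \<not> P xs \<or> Q xs)"
    using assms by (intro computable_intros computable_leaves)
  then show ?thesis by (simp only: imp_conv_disj)
qed

lemma decidable_iff [computable_intros]:
  assumes "decidable n P" "decidable n Q" shows "decidable n (\<lambda>xs. P xs \<longleftrightarrow> Q xs)"
proof -
  have "decidable n (\<lambda>xs. (P xs \<longrightarrow> Q xs) \<and> (Q xs \<longrightarrow> P xs))"
    using assms by (intro computable_intros computable_leaves)
  then show ?thesis by (simp only: iff_conv_conj_imp)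
qed

lemma computable_add [computable_intros]:
  assumes "computable n f" "computable n g" shows "computable n (\<lambda>xs. f xs + g xs)"
proof -
  have "computable n (\<lambda>xs. rec_nat (f xs) (\<lambda>k r. Suc r) (g xs))"
    using assms by (intro computable_intros computable_leaves)
  moreover have "rec_nat a (\<lambda>k r. Suc r) b = a + b" for a b :: nat by (induction b) auto
  ultimately show ?thesis by simp
qed

lemma computable_mult [computable_intros]:
  assumes "computable n f" "computable n g" shows "computable n (\<lambda>xs. f xs * g xs)"
proof -
  have "computable n (\<lambda>xs. rec_nat 0 (\<lambda>k r. r + f xs) (g xs))"
    using assms by (intro computable_intros computable_leaves)
  moreover have "rec_nat 0 (\<lambda>k r. r + a) b = a * b" for a b :: nat by (induction b) auto
  ultimately show ?thesis by simp
qed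

lemma computable_power [computable_intros]:
  assumes "computable n f" "computable n g" shows "computable n (\<lambda>xs. f xs ^ g xs)"
proof -
  have "computable n (\<lambda>xs. rec_nat 1 (\<lambda>k r. r * f xs) (g xs))"
    using assms by (intro computable_intros computable_leaves)
  moreover have "rec_nat 1 (\<lambda>k r. r * a) b = a ^ b" for a b :: nat by (induction b) auto
  ultimately show ?thesis by simp
qed

lemma computable_diff [computable_intros]:
  assumes "computable n f" "computable n g" shows "computable n (\<lambda>xs. f xs - g xs)"
proof -
  \<comment> \<open>The inner recursor ignores its accumulator and returns the last counter: it is
    the predecessor, with value 0 at 0.\<close>
  have "computable n (\<lambda>xs. rec_nat (f xs) (\<lambda>k r. rec_nat 0 (\<lambda>k r. k) r) (g xs))"
    using assms by (intro computable_intros computable_leaves)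
  moreover have "rec_nat 0 (\<lambda>k r. k) b = b - 1" for b :: nat by (cases b) auto
  moreover have "rec_nat a (\<lambda>k r. r - 1) b = a - b" for a b :: nat by (induction b) auto
  ultimately show ?thesis by simp
qed

lemma decidable_eq [computable_intros]:
  assumes "computable n f" "computable n g" shows "decidable n (\<lambda>xs. f xs = g xs)"
proof -
  have "computable n (\<lambda>xs. 1 - ((f xs - g xs) + (g xs - f xs)))"
    using assms by (intro computable_intros computable_leaves)
  then show ?thesis unfolding decidable_def by (rule computable_cong) auto
qed

lemma decidable_less [computable_intros]:
  assumes "computable n f" "computable n g" shows "decidable n (\<lambda>xs. f xs < g xs)"
proof -
  have "decidable n (\<lambda>xs. Suc (f xs) - g xs = 0)"
    using assms by (intro computable_intros computable_leaves)
  then show ?thesis by (rule decidable_cong) auto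
qed

text \<open>A recursion step sees counter, accumulator and parameters, in this order; a function of
  counter and parameters has to skip the accumulator in between.\<close>

lemma computable_skip:
  assumes "computable (Suc n) (\<lambda>xs. f (hd xs) (tl xs))"
  shows "computable (Suc (Suc n)) (\<lambda>xs. f (hd xs) (tl (tl xs)))"
proof -
  have "computable (Suc (Suc n)) (\<lambda>xs. (\<lambda>xs. f (hd xs) (tl xs))
    (map (\<lambda>g. g xs) (hd # map (\<lambda>i xs. xs ! Suc (Suc i)) [0..<n])))"
    using assms by (intro computable_comp) (auto intro: computable_nth computable_hd)
  then show ?thesis
  proof (rule computable_cong)
    fix xs :: "nat list" assume "length xs = Suc (Suc n)"
    then have "map (\<lambda>g. g xs) (map (\<lambda>i xs. xs ! Suc (Suc i)) [0..<n]) = tl (tl xs)"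
      by (intro nth_equalityI) (auto simp: nth_tl)
    then show "(\<lambda>xs. f (hd xs) (tl xs))
      (map (\<lambda>g. g xs) (hd # map (\<lambda>i xs. xs ! Suc (Suc i)) [0..<n])) = f (hd xs) (tl (tl xs))"
      by (simp del: map_map)
  qed
qed

lemma decidable_skip:
  "decidable (Suc n) (\<lambda>xs. P (hd xs) (tl xs)) \<Longrightarrow> decidable (Suc (Suc n)) (\<lambda>xs. P (hd xs) (tl (tl xs)))"
  unfolding decidable_def by (rule computable_skip)

lemma decidable_Ex_less [computable_intros]:
  assumes "computable n b" "decidable (Suc n) (\<lambda>xs. P (hd xs) (tl xs))"
  shows "decidable n (\<lambda>xs. \<exists>i<b xs. P i xs)"
proof -
  have "computable n (\<lambda>xs. rec_nat 0 (\<lambda>k r. if P k xs then 1 else r) (b xs))"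
    using assms by (intro computable_intros computable_leaves decidable_skip)
  moreover have "rec_nat 0 (\<lambda>k r. if Q k then 1 else r) m = (if \<exists>i<m. Q i then 1 else 0::nat)"
    for Q and m :: nat
    by (induction m) (auto simp: less_Suc_eq)
  ultimately show ?thesis unfolding decidable_def by (elim computable_cong) simp
qed

lemma decidable_All_less [computable_intros]:
  assumes "computable n b" "decidable (Suc n) (\<lambda>xs. P (hd xs) (tl xs))"
  shows "decidable n (\<lambda>xs. \<forall>i<b xs. P i xs)"
proof -
  have "decidable n (\<lambda>xs. \<not> (\<exists>i<b xs. \<not> P i xs))"
    using assms by (intro computable_intros computable_leaves)
  then show ?thesis by simp
qed

lemma computable_div [computable_intros]:
  assumes "computable n f" "computable n g" shows "computable n (\<lambda>xs. f xs div g xs)"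
proof -
  \<comment> \<open>The disjunct \<open>b = 0\<close> keeps the search total and makes it return 0,
    the value of \<open>a div 0\<close>.\<close>
  have div: "a div b = (LEAST q. b = 0 \<or> a < b * Suc q)" for a b :: nat
  proof (cases "b = 0")
    case True
    then show ?thesis by (simp add: Least_equality)
  next
    case False
    have "(LEAST q. b = 0 \<or> a < b * Suc q) = a div b"
    proof (rule Least_equality)
      show "b = 0 \<or> a < b * Suc (a div b)"
        using False dividend_less_times_div[of b a] by simp
      show "a div b \<le> q" if "b = 0 \<or> a < b * Suc q" for q
        using that False by (metis less_Suc_eq_le less_mult_imp_div_less mult.commute)
    qed
    then show ?thesis by simp
  qed
  have "\<exists>q. b = 0 \<or> a < b * Suc q" for a b :: nat
    using dividend_less_times_div[of b a] by (metis mult_Suc_right add.commute bot_nat_0.not_eq_extremum)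
  then show ?thesis
    unfolding div by (intro computable_intros computable_leaves assms)
qed

lemma computable_mod [computable_intros]:
  assumes "computable n f" "computable n g" shows "computable n (\<lambda>xs. f xs mod g xs)"
  unfolding modulo_nat_def minus_mult_div_eq_mod[symmetric] by (intro computable_intros computable_leaves assms)

section \<open>Pairs and lists as numbers\<close>

lemma computable_prod_encode [computable_intros]:
  assumes "computable n f" "computable n g" shows "computable n (\<lambda>xs. prod_encode (f xs, g xs))"
  unfolding prod_encode_def triangle_def prod.case by (intro computable_intros computable_leaves assms)

definition code_fst :: "nat \<Rightarrow> nat" where "code_fst c = fst (prod_decode c)"

definition code_snd :: "nat \<Rightarrow> nat" where "code_snd c = snd (prod_decode c)"

lemma code_fst_prod_encode [simp]: "code_fst (prod_encode (a, b)) = a"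
  by (simp add: code_fst_def)

lemma code_snd_prod_encode [simp]: "code_snd (prod_encode (a, b)) = b"
  by (simp add: code_snd_def)

lemma prod_encode_code_fst_code_snd [simp]: "prod_encode (code_fst c, code_snd c) = c"
  by (simp add: code_fst_def code_snd_def)

text \<open>The pairing is inverted by search: a component is at most the pair, so the missing one
  ranges below \<open>Suc c\<close>.\<close>

lemma computable_code_fst [computable_intros]:
  assumes "computable n f" shows "computable n (\<lambda>xs. code_fst (f xs))"
proof -
  have ex: "\<exists>b<Suc c. prod_encode (code_fst c, b) = c" for c
    using le_prod_encode_2[of "code_snd c" "code_fst c"] by (intro exI[of _ "code_snd c"]) auto
  have "code_fst c = (LEAST a. \<exists>b<Suc c. prod_encode (a, b) = c)" for c
    by (rule Least_equality[symmetric]) (use ex in auto)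
  moreover have "\<exists>a. \<exists>b<Suc c. prod_encode (a, b) = c" for c
    using ex by blast
  ultimately show ?thesis
    by simp (intro computable_intros computable_leaves assms)
qed

lemma computable_code_snd [computable_intros]:
  assumes "computable n f" shows "computable n (\<lambda>xs. code_snd (f xs))"
proof -
  have ex: "\<exists>a<Suc c. prod_encode (a, code_snd c) = c" for c
    using le_prod_encode_1[of "code_fst c" "code_snd c"] by (intro exI[of _ "code_fst c"]) auto
  have "code_snd c = (LEAST b. \<exists>a<Suc c. prod_encode (a, b) = c)" for c
    by (rule Least_equality[symmetric]) (use ex in auto)
  moreover have "\<exists>b. \<exists>a<Suc c. prod_encode (a, b) = c" for c
    using ex by blast
  ultimately show ?thesis
    by simp (intro computable_intros computable_leaves assms)
qed

text \<open>In \<open>list_encode\<close> a nonempty list is the successor of the pair of its head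
  and the code of its tail; \<open>r - 1\<close> removes the successor.\<close>

definition code_drop :: "nat \<Rightarrow> nat \<Rightarrow> nat" where
  "code_drop c i = rec_nat c (\<lambda>_ r. code_snd (r - 1)) i"

definition code_nth :: "nat \<Rightarrow> nat \<Rightarrow> nat" where
  "code_nth c i = code_fst (code_drop c i - 1)"

text \<open>A list is never longer than its code, so \<open>c\<close> bounds the positions; a
  nonzero remainder marks a position inside the list.\<close>

definition code_mem :: "nat \<Rightarrow> nat \<Rightarrow> bool" where
  "code_mem v c \<longleftrightarrow> (\<exists>i<c. 0 < code_drop c i \<and> code_nth c i = v)"

lemma computable_code_nth [computable_intros]:
  "computable n f \<Longrightarrow> computable n g \<Longrightarrow> computable n (\<lambda>xs. code_nth (f xs) (g xs))"
  unfolding code_nth_def code_drop_def by (intro computable_intros computable_leaves)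

lemma decidable_code_mem [computable_intros]:
  "computable n f \<Longrightarrow> computable n g \<Longrightarrow> decidable n (\<lambda>xs. code_mem (f xs) (g xs))"
  unfolding code_mem_def code_drop_def by (intro computable_intros computable_leaves)

lemma code_drop_list_encode: "code_drop (list_encode xs) i = list_encode (drop i xs)"
proof (induction i)
  case (Suc i)
  have "code_snd (list_encode ys - 1) = list_encode (tl ys)" for ys
  proof (cases ys)
    case Nil
    \<comment> \<open>0 codes the empty list and also the pair of 0 and 0, so dropping from the
      empty list stays at 0.\<close>
    then show ?thesis using code_snd_prod_encode[of 0 0] by (simp add: prod_encode_def)
  qed simp
  with Suc show ?case by (simp add: code_drop_def drop_Suc drop_tl)
qed (simp add: code_drop_def)

lemma code_nth_list_encode: "i < length xs \<Longrightarrow> code_nth (list_encode xs) i = xs ! i"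
  by (simp add: code_nth_def code_drop_list_encode Cons_nth_drop_Suc[symmetric])

lemma length_le_list_encode: "length xs \<le> list_encode xs"
proof (induction xs)
  case (Cons x xs)
  then show ?case using le_prod_encode_2[of "list_encode xs" x] by simp
qed simp

text \<open>Strict because of the successor in \<open>list_encode\<close>. All syntax is coded by
  lists, so this bounds every quantifier over syntax and makes recursion on codes
  well-founded.\<close>

lemma member_less_list_encode: "x \<in> set xs \<Longrightarrow> x < list_encode xs"
proof (induction xs)
  case (Cons y xs)
  then show ?case
    using le_prod_encode_1[of y "list_encode xs"] le_prod_encode_2[of "list_encode xs" y] by auto
qed simp

lemma code_mem_list_encode [simp]: "code_mem v (list_encode xs) \<longleftrightarrow> v \<in> set xs"
proof -
  have "0 < list_encode (drop i xs) \<longleftrightarrow> i < length xs" for i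
    by (cases "drop i xs") (auto simp: drop_eq_Nil2, (metis drop_eq_Nil leI list.distinct(1))+)
  then have "code_mem v (list_encode xs) \<longleftrightarrow> (\<exists>i<list_encode xs. i < length xs \<and> xs ! i = v)"
    by (auto simp: code_mem_def code_drop_list_encode code_nth_list_encode)
  also have "\<dots> \<longleftrightarrow> v \<in> set xs"
    using length_le_list_encode[of xs] by (auto simp: in_set_conv_nth dest: order.strict_trans2)
  finally show ?thesis .
qed

section \<open>Finite sets as bit masks\<close>

lemma decidable_set_decode [computable_intros]:
  assumes "computable n f" "computable n g" shows "decidable n (\<lambda>xs. f xs \<in> set_decode (g xs))"
  unfolding set_decode_def mem_Collect_eq odd_iff_mod_2_eq_one by (intro computable_intros computable_leaves assms)

text \<open>Bounded comprehension on masks. It lets a whole set be the accumulator of a primitive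
  recursion.\<close>

lemma computable_set_encode [computable_intros]:
  assumes "computable n b" "decidable (Suc n) (\<lambda>xs. P (hd xs) (tl xs))"
  shows "computable n (\<lambda>xs. set_encode {t. t < b xs \<and> P t xs})"
proof -
  have "rec_nat 0 (\<lambda>t r. if Q t then r + 2 ^ t else r) m = set_encode {t. t < m \<and> Q t}" for Q m
  proof (induction m)
    case (Suc m)
    have "{t. t < Suc m \<and> Q t} = (if Q m then insert m {t. t < m \<and> Q t} else {t. t < m \<and> Q t})"
      by (auto simp: less_Suc_eq)
    with Suc show ?case by simp
  qed simp
  moreover have "computable n (\<lambda>xs. rec_nat 0 (\<lambda>t r. if P t xs then r + 2 ^ t else r) (b xs))"
    by (intro computable_intros computable_leaves assms decidable_skip)
  ultimately show ?thesis by (elim computable_cong) simp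
qed

lemma set_decode_set_encode_less [simp]:
  "set_decode (set_encode {t. t < b \<and> P t}) = {t. t < (b::nat) \<and> P t}"
  by (rule set_encode_inverse) simp

lemma set_encode_less_power:
  assumes "A \<subseteq> {..<n}" shows "set_encode A < 2 ^ n"
proof -
  have "set_encode A \<le> (\<Sum>i<n. 2 ^ i)"
    unfolding set_encode_def by (rule sum_mono2) (use assms in auto)
  also have "\<dots> < 2 ^ n" by (induction n) auto
  finally show ?thesis .
qed

lemma set_decode_less_power:
  assumes "a < 2 ^ n" shows "set_decode a \<subseteq> {..<n}"
proof
  fix k assume "k \<in> set_decode a"
  then have "a div 2 ^ k \<noteq> 0" by (auto simp: set_decode_def elim: oddE)
  then have "2 ^ k \<le> a" by (metis div_less not_less)
  with assms have "(2::nat) ^ k < 2 ^ n" by (meson le_less_trans)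
  then show "k \<in> {..<n}" by simp
qed

text \<open>All pairs from a box thus lie below the code of its corner, which serves as length for
  digit strings and masks indexed by pairs.\<close>

lemma prod_encode_less:
  assumes "a < b" "c < d" shows "prod_encode (a, c) < prod_encode (b, d)"
proof -
  have tri: "triangle x \<le> triangle y" if "x \<le> y" for x y
    unfolding triangle_def using that by (intro div_le_mono mult_le_mono) auto
  have "triangle (a + c) + a < triangle (b + d) + b"
    using tri[of "a + c" "b + d"] assms by simp
  then show ?thesis by (simp add: prod_encode_def)
qed

section \<open>Invariance of the \<open>\<mu>\<close>-calculus under bisimulation\<close>

text \<open>Knaster-Tarski relative to \<open>S\<close>: the least prefixed point is a fixpoint.
  Prefixed points are the handier form, because inclusions, unlike equations, survive when
  \<open>F\<close> shrinks or is carried to another system.\<close>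

lemma Inter_fixpoints:
  assumes mono: "\<And>a b. a \<subseteq> b \<Longrightarrow> b \<subseteq> S \<Longrightarrow> F a \<subseteq> F b" and into: "\<And>a. a \<subseteq> S \<Longrightarrow> F a \<subseteq> S"
  shows "\<Inter>{\<tau>. \<tau> \<subseteq> S \<and> \<tau> = F \<tau>} = \<Inter>{\<tau>. \<tau> \<subseteq> S \<and> F \<tau> \<subseteq> \<tau>}" (is "_ = ?L")
proof -
  have LS: "?L \<subseteq> S" using into[of S] by auto
  have pre: "F ?L \<subseteq> ?L"
  proof (rule Inter_greatest, clarify)
    fix \<tau> x assume \<tau>: "\<tau> \<subseteq> S" "F \<tau> \<subseteq> \<tau>" and x: "x \<in> F ?L"
    have "?L \<subseteq> \<tau>" using \<tau> by auto
    then show "x \<in> \<tau>" using mono[of ?L \<tau>] \<tau> x by blast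
  qed
  have "F (F ?L) \<subseteq> F ?L" by (rule mono[OF pre LS])
  then have "?L \<subseteq> F ?L" using into[OF LS] by (intro Inter_lower) auto
  then have fp: "?L = F ?L" using pre by (rule equalityI)
  show ?thesis
  proof (rule equalityI)
    show "\<Inter>{\<tau>. \<tau> \<subseteq> S \<and> \<tau> = F \<tau>} \<subseteq> ?L" by (rule Inter_lower) (use LS fp in blast)
  qed auto
qed

text \<open>The dual argument: the union of all post-fixpoints is one itself, and applying
  \<open>F\<close> to it yields another.\<close>

lemma Union_fixpoints:
  assumes mono: "\<And>a b. a \<subseteq> b \<Longrightarrow> b \<subseteq> S \<Longrightarrow> F a \<subseteq> F b" and into: "\<And>a. a \<subseteq> S \<Longrightarrow> F a \<subseteq> S"
  shows "\<Union>{\<tau>. \<tau> \<subseteq> S \<and> \<tau> = F \<tau>} = \<Union>{\<tau>. \<tau> \<subseteq> S \<and> \<tau> \<subseteq> F \<tau>}" (is "_ = ?G")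
proof -
  have GS: "?G \<subseteq> S" by auto
  have post: "?G \<subseteq> F ?G"
  proof (rule Union_least, clarify)
    fix \<tau> x assume \<tau>: "\<tau> \<subseteq> S" "\<tau> \<subseteq> F \<tau>" and x: "x \<in> \<tau>"
    have "\<tau> \<subseteq> ?G" using \<tau> by auto
    then show "x \<in> F ?G" using mono[of \<tau> ?G] GS \<tau> x by blast
  qed
  have "F ?G \<subseteq> F (F ?G)" by (rule mono[OF post into[OF GS]])
  then have "F ?G \<subseteq> ?G" using into[OF GS] by (intro Union_upper) auto
  then have fp: "?G = F ?G" using post by (intro equalityI)
  show ?thesis
  proof (rule equalityI)
    show "?G \<subseteq> \<Union>{\<tau>. \<tau> \<subseteq> S \<and> \<tau> = F \<tau>}" by (rule Union_upper) (use GS fp in blast)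
  qed auto
qed

text \<open>Both halves share one induction, since the fixpoint lemmas need monotonicity and
  boundedness of the body at once.\<close>

lemma mu_sem_mono_subset:
  assumes "\<And>p. ext S p \<subseteq> states S" "\<And>h. E h \<subseteq> E' h" "\<And>h. E' h \<subseteq> states S"
  shows "mu_sem S \<phi> E \<subseteq> mu_sem S \<phi> E' \<and> mu_sem S \<phi> E' \<subseteq> states S"
  using assms(2,3)
proof (induction \<phi> arbitrary: E E')
  case (Mu h \<phi>)
  let ?F = "\<lambda>E \<tau>. mu_sem S \<phi> (E(h := \<tau>))"
  have EE: "E h \<subseteq> states S" for h using Mu.prems by blast
  have F: "\<Inter>{\<tau>. \<tau> \<subseteq> states S \<and> \<tau> = ?F D \<tau>} = \<Inter>{\<tau>. \<tau> \<subseteq> states S \<and> ?F D \<tau> \<subseteq> \<tau>}"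
    if D: "\<And>h. D h \<subseteq> states S" for D
  proof (rule Inter_fixpoints)
    show "?F D a \<subseteq> ?F D b" if "a \<subseteq> b" "b \<subseteq> states S" for a b
      by (rule Mu.IH[THEN conjunct1]) (use D that in auto)
    show "?F D a \<subseteq> states S" if "a \<subseteq> states S" for a
      by (rule Mu.IH[of "D(h := a)" "D(h := a)", THEN conjunct2]) (use D that in auto)
  qed
  have le: "?F E \<tau> \<subseteq> ?F E' \<tau> \<and> ?F E' \<tau> \<subseteq> states S" if "\<tau> \<subseteq> states S" for \<tau>
    by (rule Mu.IH) (use Mu.prems that in auto)
  show ?case
    unfolding mu_sem.simps F[OF Mu.prems(2)] F[OF EE]
  proof
    \<comment> \<open>A larger operator has fewer prefixed points, so their intersection grows; the
      full state space is always one of them.\<close>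
    show "\<Inter>{\<tau>. \<tau> \<subseteq> states S \<and> ?F E \<tau> \<subseteq> \<tau>} \<subseteq> \<Inter>{\<tau>. \<tau> \<subseteq> states S \<and> ?F E' \<tau> \<subseteq> \<tau>}"
      by (intro Inter_anti_mono Collect_mono impI) (metis le order_trans)
    show "\<Inter>{\<tau>. \<tau> \<subseteq> states S \<and> ?F E' \<tau> \<subseteq> \<tau>} \<subseteq> states S"
      by (rule Inter_lower) (use le in auto)
  qed
next
  case (Nu h \<phi>)
  let ?F = "\<lambda>E \<tau>. mu_sem S \<phi> (E(h := \<tau>))"
  have EE: "E h \<subseteq> states S" for h using Nu.prems by blast
  have F: "\<Union>{\<tau>. \<tau> \<subseteq> states S \<and> \<tau> = ?F D \<tau>} = \<Union>{\<tau>. \<tau> \<subseteq> states S \<and> \<tau> \<subseteq> ?F D \<tau>}"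
    if D: "\<And>h. D h \<subseteq> states S" for D
  proof (rule Union_fixpoints)
    show "?F D a \<subseteq> ?F D b" if "a \<subseteq> b" "b \<subseteq> states S" for a b
      by (rule Nu.IH[THEN conjunct1]) (use D that in auto)
    show "?F D a \<subseteq> states S" if "a \<subseteq> states S" for a
      by (rule Nu.IH[of "D(h := a)" "D(h := a)", THEN conjunct2]) (use D that in auto)
  qed
  have le: "?F E \<tau> \<subseteq> ?F E' \<tau>" if "\<tau> \<subseteq> states S" for \<tau>
    by (rule Nu.IH[THEN conjunct1]) (use Nu.prems that in auto)
  show ?case
    unfolding mu_sem.simps F[OF Nu.prems(2)] F[OF EE]
  proof
    show "\<Union>{\<tau>. \<tau> \<subseteq> states S \<and> \<tau> \<subseteq> ?F E \<tau>} \<subseteq> \<Union>{\<tau>. \<tau> \<subseteq> states S \<and> \<tau> \<subseteq> ?F E' \<tau>}"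
      by (intro Union_mono Collect_mono impI) (metis le order_trans)
  qed auto
next
  case (Or \<phi> \<psi>)
  from Or.IH(1)[of E E'] Or.IH(2)[of E E'] Or.prems show ?case by auto
next
  case (And \<phi> \<psi>)
  from And.IH(1)[of E E'] And.IH(2)[of E E'] And.prems show ?case by auto
next
  case (ExNext \<phi>)
  from ExNext.IH[of E E'] ExNext.prems show ?case by auto
next
  case (AllNext \<phi>)
  from AllNext.IH[of E E'] AllNext.prems show ?case by auto
qed (use assms(1) in auto)

lemma mu_sem_subset:
  "(\<And>p. ext S p \<subseteq> states S) \<Longrightarrow> (\<And>h. E h \<subseteq> states S) \<Longrightarrow> mu_sem S \<phi> E \<subseteq> states S"
  using mu_sem_mono_subset[of S E E] by blast

section \<open>Bisimulations and fixpoints\<close>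

text \<open>Beyond back and forth, the relation is total on both sides and difunctional: the fourth
  corner of a zigzag is related too. This allows sets of states to be translated to the other system
  and back.\<close>

definition bisimulation ::
  "('s, 'o) transition_system \<Rightarrow> ('t, 'o) transition_system \<Rightarrow> 'o set \<Rightarrow> ('s \<Rightarrow> 't \<Rightarrow> bool) \<Rightarrow> bool"
where
  "bisimulation S T Ob R \<longleftrightarrow>
    (\<forall>p. ext S p \<subseteq> states S) \<and> (\<forall>p. ext T p \<subseteq> states T) \<and>
    (\<forall>s t. R s t \<longrightarrow> s \<in> states S \<and> t \<in> states T) \<and>
    (\<forall>s\<in>states S. \<exists>t. R s t) \<and> (\<forall>t\<in>states T. \<exists>s. R s t) \<and>
    (\<forall>s t s' t'. R s t \<longrightarrow> R s' t \<longrightarrow> R s' t' \<longrightarrow> R s t') \<and>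
    (\<forall>s t. R s t \<longrightarrow> (\<forall>p\<in>Ob. s \<in> ext S p \<longleftrightarrow> t \<in> ext T p)) \<and>
    (\<forall>s t. R s t \<longrightarrow> (\<forall>s'\<in>succs S s. \<exists>t'\<in>succs T t. R s' t')) \<and>
    (\<forall>s t. R s t \<longrightarrow> (\<forall>t'\<in>succs T t. \<exists>s'\<in>succs S s. R s' t'))"

lemma bisimulationD:
  assumes "bisimulation S T Ob R"
  shows "ext S p \<subseteq> states S" "ext T p \<subseteq> states T"
    and "R s t \<Longrightarrow> s \<in> states S" "R s t \<Longrightarrow> t \<in> states T"
    and "s \<in> states S \<Longrightarrow> \<exists>t. R s t" "t \<in> states T \<Longrightarrow> \<exists>s. R s t"
    and "R s t \<Longrightarrow> R s' t \<Longrightarrow> R s' t' \<Longrightarrow> R s t'"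
    and "R s t \<Longrightarrow> p \<in> Ob \<Longrightarrow> s \<in> ext S p \<longleftrightarrow> t \<in> ext T p"
    and "R s t \<Longrightarrow> s' \<in> succs S s \<Longrightarrow> \<exists>t'\<in>succs T t. R s' t'"
    and "R s t \<Longrightarrow> t' \<in> succs T t \<Longrightarrow> \<exists>s'\<in>succs S s. R s' t'"
  using assms unfolding bisimulation_def by (elim conjE, metis)+

lemma bisimulation_conversep: "bisimulation S T Ob R \<Longrightarrow> bisimulation T S Ob (\<lambda>t s. R s t)"
  unfolding bisimulation_def by (elim conjE, intro conjI) metis+

text \<open>A prefixed point \<open>b\<close> is pulled back to \<open>a\<close>, the states all of
  whose partners lie in \<open>b\<close>, and forward again to \<open>b'\<close>. Totality gives
  \<open>b'\<close> inside \<open>b\<close>; difunctionality makes \<open>a\<close> and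
  \<open>b'\<close> match exactly, so \<open>rel\<close> applies and \<open>a\<close> is prefixed
  for \<open>F\<close>.\<close>

lemma bisimulation_least:
  assumes bis: "bisimulation S T Ob R" and mono: "\<And>a b. a \<subseteq> b \<Longrightarrow> b \<subseteq> states T \<Longrightarrow> G a \<subseteq> G b"
    and into: "\<And>a. a \<subseteq> states S \<Longrightarrow> F a \<subseteq> states S"
    and rel: "\<And>a b s t. a \<subseteq> states S \<Longrightarrow> b \<subseteq> states T \<Longrightarrow> (\<And>s t. R s t \<Longrightarrow> s \<in> a \<longleftrightarrow> t \<in> b) \<Longrightarrow>
      R s t \<Longrightarrow> s \<in> F a \<longleftrightarrow> t \<in> G b"
    and st: "R s t" "s \<in> \<Inter>{a. a \<subseteq> states S \<and> F a \<subseteq> a}"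
  shows "t \<in> \<Inter>{b. b \<subseteq> states T \<and> G b \<subseteq> b}"
proof (rule InterI, clarify)
  fix b assume b: "b \<subseteq> states T" "G b \<subseteq> b"
  define a where "a = {s \<in> states S. \<forall>t. R s t \<longrightarrow> t \<in> b}"
  define b' where "b' = {t \<in> states T. \<forall>s. R s t \<longrightarrow> s \<in> a}"
  have sub: "a \<subseteq> states S" "b' \<subseteq> states T" "b' \<subseteq> b"
    using bisimulationD(6)[OF bis] unfolding a_def b'_def by blast+
  have ab': "s \<in> a \<longleftrightarrow> t \<in> b'" if "R s t" for s t
    using bisimulationD(3,4,7)[OF bis] that unfolding a_def b'_def by blast
  have "G b' \<subseteq> b" using mono[OF sub(3) b(1)] b(2) by blast
  then have "F a \<subseteq> a"
    using into[OF sub(1)] rel[OF sub(1,2) ab'] unfolding a_def by blast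
  then have "s \<in> a" using st(2) sub(1) by blast
  then show "t \<in> b" using st(1) unfolding a_def by blast
qed

text \<open>Dual to the least case, with existential images in place of universal ones:
  \<open>b'\<close> now contains \<open>b\<close>, and \<open>a\<close> is a post-fixpoint.\<close>

lemma bisimulation_greatest:
  assumes bis: "bisimulation S T Ob R" and mono: "\<And>a b. a \<subseteq> b \<Longrightarrow> b \<subseteq> states T \<Longrightarrow> G a \<subseteq> G b"
    and rel: "\<And>a b s t. a \<subseteq> states S \<Longrightarrow> b \<subseteq> states T \<Longrightarrow> (\<And>s t. R s t \<Longrightarrow> s \<in> a \<longleftrightarrow> t \<in> b) \<Longrightarrow>
      R s t \<Longrightarrow> s \<in> F a \<longleftrightarrow> t \<in> G b"
    and st: "R s t" "t \<in> \<Union>{b. b \<subseteq> states T \<and> b \<subseteq> G b}"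
  shows "s \<in> \<Union>{a. a \<subseteq> states S \<and> a \<subseteq> F a}"
proof -
  obtain b where b: "b \<subseteq> states T" "b \<subseteq> G b" "t \<in> b" using st(2) by blast
  define a where "a = {s. \<exists>t. R s t \<and> t \<in> b}"
  define b' where "b' = {t. \<exists>s. R s t \<and> s \<in> a}"
  have sub: "a \<subseteq> states S" "b' \<subseteq> states T" "b \<subseteq> b'"
    using bisimulationD(3,4,6)[OF bis] b(1) unfolding a_def b'_def by blast+
  have ab': "s \<in> a \<longleftrightarrow> t \<in> b'" if "R s t" for s t
    using bisimulationD(7)[OF bis] that unfolding a_def b'_def by blast
  have "b \<subseteq> G b'" using mono[OF sub(3,2)] b(2) by blast
  then have "a \<subseteq> F a"
    using rel[OF sub(1,2) ab'] unfolding a_def by blast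
  moreover have "s \<in> a" using st(1) b(3) unfolding a_def by blast
  ultimately show ?thesis using sub(1) by blast
qed

text \<open>Agreement is asked only on free variables, so for a closed formula any two environments
  may be compared. At a binder, the fixpoint lemmas feed in sets that match along
  \<open>R\<close>.\<close>

lemma bisimulation_mu_sem:
  assumes bis: "bisimulation S T Ob R" and "formula_obs \<phi> \<subseteq> Ob"
    and "\<And>h. E h \<subseteq> states S" "\<And>h. D h \<subseteq> states T"
    and "\<And>h s t. h \<in> free_vars \<phi> \<Longrightarrow> R s t \<Longrightarrow> s \<in> E h \<longleftrightarrow> t \<in> D h" and "R s t"
  shows "s \<in> mu_sem S \<phi> E \<longleftrightarrow> t \<in> mu_sem T \<phi> D"
  using assms(2-)
proof (induction \<phi> arbitrary: E D s t)
  case (Or \<phi> \<psi>)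
  have "s \<in> mu_sem S \<phi> E \<longleftrightarrow> t \<in> mu_sem T \<phi> D" "s \<in> mu_sem S \<psi> E \<longleftrightarrow> t \<in> mu_sem T \<psi> D"
    by (rule Or.IH(1); use Or.prems in auto)
      (rule Or.IH(2); use Or.prems in auto)
  then show ?case by simp
next
  case (And \<phi> \<psi>)
  have "s \<in> mu_sem S \<phi> E \<longleftrightarrow> t \<in> mu_sem T \<phi> D" "s \<in> mu_sem S \<psi> E \<longleftrightarrow> t \<in> mu_sem T \<psi> D"
    by (rule And.IH(1); use And.prems in auto)
      (rule And.IH(2); use And.prems in auto)
  then show ?case by simp
next
  case (ExNext \<phi>)
  have IH: "s' \<in> mu_sem S \<phi> E \<longleftrightarrow> t' \<in> mu_sem T \<phi> D" if "R s' t'" for s' t'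
    by (rule ExNext.IH) (use ExNext.prems that in auto)
  then show ?case
    using bisimulationD(3,4,9,10)[OF bis \<open>R s t\<close>] unfolding mu_sem.simps by blast
next
  case (AllNext \<phi>)
  have IH: "s' \<in> mu_sem S \<phi> E \<longleftrightarrow> t' \<in> mu_sem T \<phi> D" if "R s' t'" for s' t'
    by (rule AllNext.IH) (use AllNext.prems that in auto)
  then show ?case
    using bisimulationD(3,4,9,10)[OF bis \<open>R s t\<close>] unfolding mu_sem.simps by blast
next
  case (Mu h \<phi>)
  let ?F = "\<lambda>\<tau>. mu_sem S \<phi> (E(h := \<tau>))" and ?G = "\<lambda>\<tau>. mu_sem T \<phi> (D(h := \<tau>))"
  have ext: "ext S p \<subseteq> states S" "ext T p \<subseteq> states T" for p
    using bisimulationD(1,2)[OF bis] by blast+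
  have F: "a \<subseteq> b \<Longrightarrow> b \<subseteq> states S \<Longrightarrow> ?F a \<subseteq> ?F b" "a \<subseteq> states S \<Longrightarrow> ?F a \<subseteq> states S" for a b
    by (rule mu_sem_mono_subset[THEN conjunct1]; use ext Mu.prems in auto)
      (rule mu_sem_subset; use ext Mu.prems in auto)
  have G: "a \<subseteq> b \<Longrightarrow> b \<subseteq> states T \<Longrightarrow> ?G a \<subseteq> ?G b" "a \<subseteq> states T \<Longrightarrow> ?G a \<subseteq> states T" for a b
    by (rule mu_sem_mono_subset[THEN conjunct1]; use ext Mu.prems in auto)
      (rule mu_sem_subset; use ext Mu.prems in auto)
  have rel: "s \<in> ?F a \<longleftrightarrow> t \<in> ?G b"
    if "a \<subseteq> states S" "b \<subseteq> states T" "\<And>s t. R s t \<Longrightarrow> s \<in> a \<longleftrightarrow> t \<in> b" "R s t" for a b s t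
    by (rule Mu.IH) (use that Mu.prems in auto)
  have S: "mu_sem S (Mu h \<phi>) E = \<Inter>{a. a \<subseteq> states S \<and> ?F a \<subseteq> a}"
    unfolding mu_sem.simps by (rule Inter_fixpoints) (fact F)+
  have T: "mu_sem T (Mu h \<phi>) D = \<Inter>{b. b \<subseteq> states T \<and> ?G b \<subseteq> b}"
    unfolding mu_sem.simps by (rule Inter_fixpoints) (fact G)+
  show ?case
    unfolding S T
  proof (rule iffI)
    show "t \<in> \<Inter>{b. b \<subseteq> states T \<and> ?G b \<subseteq> b}" if "s \<in> \<Inter>{a. a \<subseteq> states S \<and> ?F a \<subseteq> a}"
      using bis G(1) F(2) rel Mu.prems(5) that by (rule bisimulation_least)
    show "s \<in> \<Inter>{a. a \<subseteq> states S \<and> ?F a \<subseteq> a}" if "t \<in> \<Inter>{b. b \<subseteq> states T \<and> ?G b \<subseteq> b}"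
      using bisimulation_conversep[OF bis] F(1) G(2) rel[symmetric] Mu.prems(5) that
      by (rule bisimulation_least) blast+
  qed
next
  case (Nu h \<phi>)
  let ?F = "\<lambda>\<tau>. mu_sem S \<phi> (E(h := \<tau>))" and ?G = "\<lambda>\<tau>. mu_sem T \<phi> (D(h := \<tau>))"
  have ext: "ext S p \<subseteq> states S" "ext T p \<subseteq> states T" for p
    using bisimulationD(1,2)[OF bis] by blast+
  have F: "a \<subseteq> b \<Longrightarrow> b \<subseteq> states S \<Longrightarrow> ?F a \<subseteq> ?F b" "a \<subseteq> states S \<Longrightarrow> ?F a \<subseteq> states S" for a b
    by (rule mu_sem_mono_subset[THEN conjunct1]; use ext Nu.prems in auto)
      (rule mu_sem_subset; use ext Nu.prems in auto)
  have G: "a \<subseteq> b \<Longrightarrow> b \<subseteq> states T \<Longrightarrow> ?G a \<subseteq> ?G b" "a \<subseteq> states T \<Longrightarrow> ?G a \<subseteq> states T" for a b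
    by (rule mu_sem_mono_subset[THEN conjunct1]; use ext Nu.prems in auto)
      (rule mu_sem_subset; use ext Nu.prems in auto)
  have rel: "s \<in> ?F a \<longleftrightarrow> t \<in> ?G b"
    if "a \<subseteq> states S" "b \<subseteq> states T" "\<And>s t. R s t \<Longrightarrow> s \<in> a \<longleftrightarrow> t \<in> b" "R s t" for a b s t
    by (rule Nu.IH) (use that Nu.prems in auto)
  have S: "mu_sem S (Nu h \<phi>) E = \<Union>{a. a \<subseteq> states S \<and> a \<subseteq> ?F a}"
    unfolding mu_sem.simps by (rule Union_fixpoints) (fact F)+
  have T: "mu_sem T (Nu h \<phi>) D = \<Union>{b. b \<subseteq> states T \<and> b \<subseteq> ?G b}"
    unfolding mu_sem.simps by (rule Union_fixpoints) (fact G)+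
  show ?case
    unfolding S T
  proof (rule iffI)
    show "s \<in> \<Union>{a. a \<subseteq> states S \<and> a \<subseteq> ?F a}" if "t \<in> \<Union>{b. b \<subseteq> states T \<and> b \<subseteq> ?G b}"
      using bis G(1) rel Nu.prems(5) that by (rule bisimulation_greatest)
    show "t \<in> \<Union>{b. b \<subseteq> states T \<and> b \<subseteq> ?G b}" if "s \<in> \<Union>{a. a \<subseteq> states S \<and> a \<subseteq> ?F a}"
      using bisimulation_conversep[OF bis] F(1) rel[symmetric] Nu.prems(5) that
      by (rule bisimulation_greatest) blast+
  qed
qed (use bisimulationD(3,4,8)[OF bis] in auto)

section \<open>Symbolic states\<close>

text \<open>The old values \<open>u i\<close> already have partners \<open>w i\<close>; the values
  \<open>u' j\<close> not among them receive distinct partners from the reservoir \<open>T\<close>.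
  With empty \<open>I\<close> this is merely an injection into \<open>T\<close>.\<close>

lemma extend_matching:
  fixes u :: "'i \<Rightarrow> 'a" and u' :: "'j \<Rightarrow> 'a" and w :: "'i \<Rightarrow> 'b"
  assumes match: "\<And>i j. i \<in> I \<Longrightarrow> j \<in> I \<Longrightarrow> u i = u j \<longleftrightarrow> w i = w j"
    and fin: "finite J" and T: "infinite T \<or> card J \<le> card T" "T \<inter> w ` I = {}"
  obtains F where "inj_on F (u ` I \<union> u' ` J)" "\<And>i. i \<in> I \<Longrightarrow> F (u i) = w i"
    "\<And>j. j \<in> J \<Longrightarrow> u' j \<notin> u ` I \<Longrightarrow> F (u' j) \<in> T"
proof -
  let ?N = "u' ` J - u ` I"
  have "card ?N \<le> card J"
    using fin by (meson Diff_subset card_image_le card_mono finite_imageI order_trans)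
  then obtain T' where T': "T' \<subseteq> T" "finite T'" "card T' = card ?N"
    using T(1) fin by (metis infinite_arbitrarily_large obtain_subset_with_card_n order_trans)
  then obtain g where g: "bij_betw g ?N T'"
    using fin by (metis finite_Diff finite_imageI finite_same_card_bij)
  \<comment> \<open>Any preimage will do: by \<open>match\<close>, all of them carry the same
    \<open>w\<close>.\<close>
  define f where "f a = w (SOME i. i \<in> I \<and> u i = a)" for a
  have f: "f (u i) = w i" if "i \<in> I" for i
  proof -
    have "(SOME j. j \<in> I \<and> u j = u i) \<in> I \<and> u (SOME j. j \<in> I \<and> u j = u i) = u i"
      by (rule someI[of _ i]) (use that in simp)
    then show ?thesis unfolding f_def using match that by metis
  qed
  define F where "F a = (if a \<in> u ` I then f a else g a)" for a
  have Fg: "F a \<in> T'" "F a = g a" if "a \<in> ?N" for a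
    using that bij_betwE[OF g] by (auto simp: F_def)
  have Fw: "F (u i) = w i" if "i \<in> I" for i
    using that by (simp add: F_def f)
  have "inj_on F (u ` I \<union> ?N)"
  proof (rule inj_on_Un[THEN iffD2], intro conjI)
    show "inj_on F (u ` I)" by (auto intro!: inj_onI simp: Fw match)
    show "inj_on F ?N" using bij_betw_imp_inj_on[OF g] by (simp only: inj_on_cong[OF Fg(2)])
    have "F ` (u ` I) \<subseteq> w ` I" by (auto simp: Fw)
    moreover have "F ` ?N \<subseteq> T" using Fg T'(1) by blast
    ultimately show "F ` (u ` I - ?N) \<inter> F ` (?N - u ` I) = {}" using T(2) by blast
  qed
  then have "inj_on F (u ` I \<union> u' ` J)" by (simp add: Un_Diff_cancel)
  moreover have "F (u' j) \<in> T" if "j \<in> J" "u' j \<notin> u ` I" for j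
    using Fg(1)[of "u' j"] T'(1) that by blast
  ultimately show thesis using Fw that by blast
qed

section \<open>Equality patterns and steps between them\<close>

type_synonym yterm = "nat + nat \<times> nat"

definition yterms :: "program \<Rightarrow> yterm set" where
  "yterms P = Inl ` set (y_vars P) \<union> Inr ` (set (arrays P) \<times> set (x_vars P))"

fun yval :: "('a, 'b) state \<Rightarrow> yterm \<Rightarrow> 'b" where
  "yval s (Inl y) = y_val s y"
| "yval s (Inr (a, x)) = the (array_val s a (x_val s x))"

definition similar :: "program \<Rightarrow> ('a, 'b) state \<Rightarrow> ('c, 'd) state \<Rightarrow> bool" where
  "similar P s t \<longleftrightarrow>
    (\<forall>b\<in>set (bool_vars P). bool_val s b = bool_val t b) \<and>
    (\<forall>x\<in>set (x_vars P). \<forall>x'\<in>set (x_vars P). x_val s x = x_val s x' \<longleftrightarrow> x_val t x = x_val t x') \<and>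
    (\<forall>i\<in>yterms P. \<forall>j\<in>yterms P. yval s i = yval s j \<longleftrightarrow> yval t i = yval t j)"

lemma similarI:
  assumes "\<And>b. b \<in> set (bool_vars P) \<Longrightarrow> bool_val s b = bool_val t b"
    and "\<And>x. x \<in> set (x_vars P) \<Longrightarrow> x_val t x = F (x_val s x)" "inj_on F (x_val s ` set (x_vars P))"
    and "\<And>i. i \<in> yterms P \<Longrightarrow> yval t i = G (yval s i)" "inj_on G (yval s ` yterms P)"
  shows "similar P s t"
  using assms unfolding similar_def by (auto simp: inj_on_eq_iff)

lemma similar_sym: "similar P s t \<Longrightarrow> similar P t s"
  unfolding similar_def by simp

lemma similar_trans: "similar P s t \<Longrightarrow> similar P t r \<Longrightarrow> similar P s r"
  unfolding similar_def by simp

lemma similar_beval: "similar P s t \<Longrightarrow> wf_bexp P e \<Longrightarrow> beval s e \<longleftrightarrow> beval t e"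
proof (induction e)
  case (EqY z z')
  then have "yval s (Inl z) = yval s (Inl z') \<longleftrightarrow> yval t (Inl z) = yval t (Inl z')"
    unfolding similar_def yterms_def by (auto simp del: yval.simps)
  then show ?case by simp
qed (auto simp: similar_def)

lemma finite_yterms: "finite (yterms P)"
  by (simp add: yterms_def)

lemma InlI_yterms: "y \<in> set (y_vars P) \<Longrightarrow> Inl y \<in> yterms P"
  and InrI_yterms: "a \<in> set (arrays P) \<Longrightarrow> x \<in> set (x_vars P) \<Longrightarrow> Inr (a, x) \<in> yterms P"
  by (simp_all add: yterms_def)

text \<open>\<open>step_array\<close> seen at the new X-values only. An index that is no old X-value
  can only come from \<open>x := ?\<close>, and its entry is left free; the proviso on undefined
  entries thus becomes a test against the old X-values.\<close>

definition step_row ::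
  "program \<Rightarrow> assignment set \<Rightarrow> ('a, 'b) state \<Rightarrow> ('a, 'b) state \<Rightarrow> bool" where
  "step_row P I s s' \<longleftrightarrow> (\<forall>a\<in>set (arrays P). \<forall>x'\<in>set (x_vars P).
    (\<forall>x y. Write a x y \<in> I \<and> x_val s x = x_val s' x' \<longrightarrow>
      array_val s' a (x_val s' x') = Some (y_val s y)) \<and>
    ((\<nexists>x y. Write a x y \<in> I \<and> x_val s x = x_val s' x') \<longrightarrow>
      (\<exists>x\<in>set (x_vars P). x_val s x = x_val s' x') \<longrightarrow>
      array_val s' a (x_val s' x') = array_val s a (x_val s' x')))"

definition symbolic_step ::
  "program \<Rightarrow> ('a, 'b) state \<Rightarrow> ('a, 'b) state \<Rightarrow> bool" where
  "symbolic_step P s s' \<longleftrightarrow> (\<exists>(e, I)\<in>set (commands P). beval s e \<and>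
    step_bool P (set I) s s' \<and> step_x P (set I) s s' \<and>
    step_y P (set I) s s' \<and> step_row P (set I) s s')"

lemma program_statesD:
  assumes "s \<in> program_states P A B"
  shows "x \<in> set (x_vars P) \<Longrightarrow> x_val s x \<in> A" "y \<in> set (y_vars P) \<Longrightarrow> y_val s y \<in> B"
    and "a \<in> set (arrays P) \<Longrightarrow> finite (dom (array_val s a))"
    and "a \<in> set (arrays P) \<Longrightarrow> dom (array_val s a) \<subseteq> A"
    and "a \<in> set (arrays P) \<Longrightarrow> ran (array_val s a) \<subseteq> B"
    and "a \<in> set (arrays P) \<Longrightarrow> x \<in> set (x_vars P) \<Longrightarrow> x_val s x \<in> dom (array_val s a)"
  using assms unfolding program_states_def by (auto simp: PiE_iff)

lemma array_val_yval:
  assumes "s \<in> program_states P A B" "a \<in> set (arrays P)" "x \<in> set (x_vars P)"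
  shows "array_val s a (x_val s x) = Some (yval s (Inr (a, x)))"
  using program_statesD(6)[OF assms] by auto

lemma yval_in:
  assumes "s \<in> program_states P A B" "i \<in> yterms P" shows "yval s i \<in> B"
proof -
  have "yval s (Inr (a, x)) \<in> B" if "a \<in> set (arrays P)" "x \<in> set (x_vars P)" for a x
    using array_val_yval[OF assms(1) that] program_statesD(5)[OF assms(1) that(1)] by (meson ranI subsetD)
  then show ?thesis
    using assms program_statesD(2)[OF assms(1)] by (auto simp: yterms_def simp del: yval.simps(2))
qed

text \<open>
  A value of an array outside the current values of the \<open>X\<close>-variables never matters, so the
  symbolic states may be given by finitely many numbers below a bound \<open>L\<close>; here \<open>dec\<close> reads
  the symbolic state off a code below \<open>M\<close>.
\<close>

locale symbolic =
  fixes P :: program and L M :: nat and dec :: "nat \<Rightarrow> (nat, nat) state"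
  assumes wf: "wf_program P"
    and L_x: "2 * card (set (x_vars P)) \<le> L" and L_y: "2 * card (yterms P) \<le> L" and L_pos: "0 < L"
    and dec_x: "x_val (dec c) x < L" and dec_y: "y_val (dec c) y < L"
    and dec_array: "\<exists>w<L. array_val (dec c) a v = Some w"
    and dec_ex: "\<And>bv xv yv av. (\<And>x. xv x < L) \<Longrightarrow> (\<And>y. yv y < L) \<Longrightarrow> (\<And>a v. av a v < L) \<Longrightarrow>
      \<exists>c<M. (\<forall>b\<in>set (bool_vars P). bool_val (dec c) b = bv b) \<and>
        (\<forall>x\<in>set (x_vars P). x_val (dec c) x = xv x) \<and>
        (\<forall>y\<in>set (y_vars P). y_val (dec c) y = yv y) \<and>
        (\<forall>a\<in>set (arrays P). \<forall>v<L. array_val (dec c) a v = Some (av a v))"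
begin

definition symbolic_ts :: "(nat, nat) transition_system" where
  "symbolic_ts = \<lparr>states = {..<M}, succs = (\<lambda>c. {c'. c' < M \<and> symbolic_step P (dec c) (dec c')}),
    observables = set (bool_vars P), ext = (\<lambda>b. {c. c < M \<and> bool_val (dec c) b})\<rparr>"

lemma yval_dec: "array_val (dec c) a (x_val (dec c) x) = Some (yval (dec c) (Inr (a, x)))"
  using dec_array[of c a "x_val (dec c) x"] by auto

lemma yval_dec_less: "yval (dec c) i < L"
  using dec_array[of c] dec_y[of c]
  by (cases "(dec c, i)" rule: yval.cases) (auto, metis option.sel)

text \<open>X-values are relabelled by \<open>F\<close> and Y-values by \<open>G\<close>. Array
  entries are stored under the relabelled index, so injectivity of \<open>F\<close> keeps them well
  defined.\<close>

lemma realize_symbolic: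
  assumes s: "s \<in> program_states P A B"
    and F: "inj_on F (x_val s ` set (x_vars P))" "\<And>x. x \<in> set (x_vars P) \<Longrightarrow> F (x_val s x) < L"
    and G: "\<And>i. i \<in> yterms P \<Longrightarrow> G (yval s i) < L"
  obtains c where "c < M" "\<And>b. b \<in> set (bool_vars P) \<Longrightarrow> bool_val (dec c) b = bool_val s b"
    "\<And>x. x \<in> set (x_vars P) \<Longrightarrow> x_val (dec c) x = F (x_val s x)"
    "\<And>i. i \<in> yterms P \<Longrightarrow> yval (dec c) i = G (yval s i)"
proof -
  let ?X = "set (x_vars P)"
  \<comment> \<open>The default 0 off the program's variables is a legal value because
    \<open>0 < L\<close>.\<close>
  define xv where "xv x = (if x \<in> ?X then F (x_val s x) else 0)" for x
  define yv where "yv y = (if y \<in> set (y_vars P) then G (y_val s y) else 0)" for y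
  \<comment> \<open>An entry is read through some variable having the given value; by injectivity of
    \<open>F\<close> it does not matter which.\<close>
  define av where "av a v = (if a \<in> set (arrays P) \<and> v \<in> xv ` ?X
    then G (yval s (Inr (a, inv_into ?X xv v))) else 0)" for a v
  have av: "av a (xv x) = G (yval s (Inr (a, x)))" if "a \<in> set (arrays P)" "x \<in> ?X" for a x
  proof -
    let ?x = "inv_into ?X xv (xv x)"
    have x: "?x \<in> ?X" "xv ?x = xv x"
      using that by (auto intro: inv_into_into f_inv_into_f)
    then have "F (x_val s ?x) = F (x_val s x)"
      using that by (simp add: xv_def)
    then have "x_val s ?x = x_val s x"
      by (rule inj_onD[OF F(1)]) (use x that in simp_all)
    then show ?thesis using that by (simp add: av_def)
  qed
  have "xv x < L" "yv y < L" "av a v < L" for x y a v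
    using F(2) G[OF InlI_yterms] G[OF InrI_yterms] L_pos
    by (auto simp: xv_def yv_def av_def inv_into_into simp del: yval.simps(2))
  from dec_ex[of xv yv av "bool_val s", OF this] obtain c where c: "c < M"
    "\<And>b. b \<in> set (bool_vars P) \<Longrightarrow> bool_val (dec c) b = bool_val s b"
    "\<And>x. x \<in> ?X \<Longrightarrow> x_val (dec c) x = xv x"
    "\<And>y. y \<in> set (y_vars P) \<Longrightarrow> y_val (dec c) y = yv y"
    "\<And>a v. a \<in> set (arrays P) \<Longrightarrow> v < L \<Longrightarrow> array_val (dec c) a v = Some (av a v)"
    by blast
  have "yval (dec c) i = G (yval s i)" if "i \<in> yterms P" for i
    using that c(3)[symmetric] dec_x
    by (auto simp: yterms_def c(4) yv_def c(5) simp flip: c(3)) (simp_all add: c(3) av del: yval.simps(2), simp)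
  moreover have "x_val (dec c) x = F (x_val s x)" if "x \<in> ?X" for x
    using c(3) that by (simp add: xv_def)
  ultimately show thesis using c(1,2) that by blast
qed

text \<open>The converse passage. The map \<open>m\<close> prescribes the arrays away from the
  X-values of the state being built: empty for an arbitrary state, the updated old arrays for a
  successor.\<close>

lemma realize_concrete:
  fixes c :: nat
  assumes F: "inj_on F (x_val (dec c) ` set (x_vars P))"
    and FA: "\<And>x. x \<in> set (x_vars P) \<Longrightarrow> F (x_val (dec c) x) \<in> A"
    and GB: "\<And>i. i \<in> yterms P \<Longrightarrow> G (yval (dec c) i) \<in> B"
    and m: "\<And>a. a \<in> set (arrays P) \<Longrightarrow> finite (dom (m a))"
      "\<And>a. a \<in> set (arrays P) \<Longrightarrow> dom (m a) \<subseteq> A" "\<And>a. a \<in> set (arrays P) \<Longrightarrow> ran (m a) \<subseteq> B"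
  obtains s where "s \<in> program_states P A B"
    "\<And>b. b \<in> set (bool_vars P) \<Longrightarrow> bool_val s b = bool_val (dec c) b"
    "\<And>x. x \<in> set (x_vars P) \<Longrightarrow> x_val s x = F (x_val (dec c) x)"
    "\<And>i. i \<in> yterms P \<Longrightarrow> yval s i = G (yval (dec c) i)"
    "\<And>a v. a \<in> set (arrays P) \<Longrightarrow> v \<notin> x_val s ` set (x_vars P) \<Longrightarrow> array_val s a v = m a v"
proof -
  let ?X = "set (x_vars P)" and ?t = "dec c"
  define f where "f x = F (x_val ?t x)" for x
  define av where "av a v = (if v \<in> f ` ?X
    then Some (G (yval ?t (Inr (a, inv_into ?X f v)))) else m a v)" for a v
  have av: "av a (f x) = Some (G (yval ?t (Inr (a, x))))" if "x \<in> ?X" for a x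
  proof -
    let ?x = "inv_into ?X f (f x)"
    have x: "?x \<in> ?X" "f ?x = f x"
      using that by (auto intro: inv_into_into f_inv_into_f)
    then have "x_val ?t ?x = x_val ?t x"
      unfolding f_def by (elim inj_onD[OF F(1)]) (use x that in simp_all)
    then show ?thesis using that by (simp add: av_def)
  qed
  define s where "s = \<lparr>bool_val = restrict (bool_val ?t) (set (bool_vars P)),
    x_val = restrict f ?X, y_val = restrict (\<lambda>y. G (y_val ?t y)) (set (y_vars P)),
    array_val = restrict av (set (arrays P))\<rparr>"
  have dom: "dom (av a) = f ` ?X \<union> dom (m a)" for a
    by (auto simp: av_def split: if_splits)
  have ran: "ran (av a) \<subseteq> B" if "a \<in> set (arrays P)" for a
  proof
    fix w assume "w \<in> ran (av a)"
    then obtain v where v: "av a v = Some w" by (auto simp: ran_def)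
    show "w \<in> B"
    proof (cases "v \<in> f ` ?X")
      case True
      then show ?thesis using v GB[OF InrI_yterms[OF that]] by (auto simp: av simp del: yval.simps(2))
    next
      case False
      then show ?thesis using v m(3)[OF that] by (auto simp: av_def ran_def)
    qed
  qed
  have "finite (dom (av a)) \<and> dom (av a) \<subseteq> A \<and> ran (av a) \<subseteq> B \<and> (\<forall>x\<in>?X. f x \<in> dom (av a))"
    if "a \<in> set (arrays P)" for a
    unfolding dom using m(1,2)[OF that] ran[OF that] FA by (simp add: f_def image_subset_iff)
  then have "s \<in> program_states P A B"
    using FA GB[OF InlI_yterms] by (simp add: program_states_def s_def restrict_PiE_iff f_def)
  moreover have "yval s i = G (yval ?t i)" if "i \<in> yterms P" for i
    using that by (auto simp: yterms_def s_def av simp del: yval.simps(2)) (auto simp: av)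
  ultimately show thesis
    by (intro that[of s]) (auto simp: s_def f_def[symmetric] av_def)
qed

lemma symbolic_total:
  assumes "s \<in> program_states P A B"
  shows "\<exists>c<M. similar P s (dec c)"
proof -
  obtain F where F: "inj_on F (x_val s ` set (x_vars P))"
    "\<And>x. x \<in> set (x_vars P) \<Longrightarrow> F (x_val s x) \<in> {..<L}"
    using extend_matching[of "{}" undefined undefined "set (x_vars P)" "{..<L}" "x_val s"] L_x by auto
  obtain G where G: "inj_on G (yval s ` yterms P)" "\<And>i. i \<in> yterms P \<Longrightarrow> G (yval s i) \<in> {..<L}"
    using extend_matching[of "{}" undefined undefined "yterms P" "{..<L}" "yval s"] L_y finite_yterms
    by auto
  obtain c where "c < M" "\<And>b. b \<in> set (bool_vars P) \<Longrightarrow> bool_val (dec c) b = bool_val s b"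
    "\<And>x. x \<in> set (x_vars P) \<Longrightarrow> x_val (dec c) x = F (x_val s x)"
    "\<And>i. i \<in> yterms P \<Longrightarrow> yval (dec c) i = G (yval s i)"
    using realize_symbolic[OF assms F(1), of G] F(2) G(2) by auto
  then show ?thesis
    using F(1) G(1) by (intro exI[of _ c]) (auto intro: similarI)
qed

lemma concrete_total:
  assumes "infinite A" "infinite B"
  shows "\<exists>s\<in>program_states P A B. similar P s (dec c)"
proof -
  let ?t = "dec c"
  obtain F where F: "inj_on F (x_val ?t ` set (x_vars P))"
    "\<And>x. x \<in> set (x_vars P) \<Longrightarrow> F (x_val ?t x) \<in> A"
    using extend_matching[of "{}" undefined undefined "set (x_vars P)" A "x_val ?t"] assms by auto
  obtain G where G: "inj_on G (yval ?t ` yterms P)" "\<And>i. i \<in> yterms P \<Longrightarrow> G (yval ?t i) \<in> B"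
    using extend_matching[of "{}" undefined undefined "yterms P" B "yval ?t"] assms finite_yterms
    by auto
  show ?thesis
  proof (rule realize_concrete[where F = F and G = G and A = A and B = B and c = c
        and m = "\<lambda>_. Map.empty"])
    fix s assume "s \<in> program_states P A B"
      "\<And>b. b \<in> set (bool_vars P) \<Longrightarrow> bool_val s b = bool_val ?t b"
      "\<And>x. x \<in> set (x_vars P) \<Longrightarrow> x_val s x = F (x_val ?t x)"
      "\<And>i. i \<in> yterms P \<Longrightarrow> yval s i = G (yval ?t i)"
    then show ?thesis
      using F(1) G(1) by (intro bexI[of _ s] similar_sym[OF similarI]) auto
  qed (use F G(2) in auto)
qed

section \<open>The two directions of the step matching\<close>

text \<open>The correspondence between \<open>s\<close> and \<open>dec c\<close> is extended to the
  values of \<open>s'\<close>, and the symbolic successor is \<open>s'\<close> relabelled by this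
  extension.\<close>

lemma symbolic_step_forth:
  assumes s: "s \<in> program_states P A B" and s': "s' \<in> succs (program_ts P A B) s"
    and sim: "similar P s (dec c)"
  shows "\<exists>c'<M. symbolic_step P (dec c) (dec c') \<and> similar P s' (dec c')"
proof -
  let ?X = "set (x_vars P)" and ?t = "dec c"
  from s' obtain e I where cmd: "(e, I) \<in> set (commands P)" and s'_in: "s' \<in> program_states P A B"
    and e: "beval s e" and steps: "step_bool P (set I) s s'" "step_x P (set I) s s'"
    "step_y P (set I) s s'" "step_array P A (set I) s s'"
    by (auto simp: program_ts_def)
  have wfI: "wf_bexp P e" "\<And>i. i \<in> set I \<Longrightarrow> wf_assignment P i"
    using wf cmd unfolding wf_program_def by auto
  \<comment> \<open>The old values use up at most half of the range below \<open>L\<close>; the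
    other half receives the new ones.\<close>
  have "card ({..<L} - x_val ?t ` ?X) \<ge> card ?X"
    using card_image_le[of ?X "x_val ?t"] L_x dec_x by (subst card_Diff_subset) auto
  then obtain F where F: "inj_on F (x_val s ` ?X \<union> x_val s' ` ?X)"
    "\<And>x. x \<in> ?X \<Longrightarrow> F (x_val s x) = x_val ?t x"
    "\<And>x. x \<in> ?X \<Longrightarrow> x_val s' x \<notin> x_val s ` ?X \<Longrightarrow> F (x_val s' x) \<in> {..<L} - x_val ?t ` ?X"
    using extend_matching[of ?X "x_val s" "x_val ?t" ?X "{..<L} - x_val ?t ` ?X" "x_val s'"] sim
    unfolding similar_def by blast
  have "card ({..<L} - yval ?t ` yterms P) \<ge> card (yterms P)"
    using card_image_le[OF finite_yterms, of "yval ?t" P] L_y yval_dec_less finite_yterms[of P]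
    by (subst card_Diff_subset) auto
  then obtain G where G: "inj_on G (yval s ` yterms P \<union> yval s' ` yterms P)"
    "\<And>i. i \<in> yterms P \<Longrightarrow> G (yval s i) = yval ?t i"
    "\<And>i. i \<in> yterms P \<Longrightarrow> yval s' i \<notin> yval s ` yterms P \<Longrightarrow>
      G (yval s' i) \<in> {..<L} - yval ?t ` yterms P"
    using extend_matching[of "yterms P" "yval s" "yval ?t" "yterms P" "{..<L} - yval ?t ` yterms P"
        "yval s'"] sim finite_yterms[of P]
    unfolding similar_def by blast
  have FL: "F (x_val s' x) < L" if "x \<in> ?X" for x
    using F(2,3)[of x] F(2) that dec_x by (cases "x_val s' x \<in> x_val s ` ?X") force+
  have GL: "G (yval s' i) < L" if "i \<in> yterms P" for i
    using G(3)[OF that] G(2) yval_dec_less by (cases "yval s' i \<in> yval s ` yterms P") force+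
  have inj: "inj_on F (x_val s' ` ?X)" "inj_on G (yval s' ` yterms P)"
    using F(1) G(1) by (auto intro: inj_on_subset)
  obtain c' where c': "c' < M" "\<And>b. b \<in> set (bool_vars P) \<Longrightarrow> bool_val (dec c') b = bool_val s' b"
    "\<And>x. x \<in> ?X \<Longrightarrow> x_val (dec c') x = F (x_val s' x)"
    "\<And>i. i \<in> yterms P \<Longrightarrow> yval (dec c') i = G (yval s' i)"
    using realize_symbolic[OF s'_in inj(1), of G] FL GL by auto
  let ?t' = "dec c'"
  have sim': "similar P s' ?t'"
    using c'(2-4) inj by (intro similarI[of P s' ?t' F G]) auto
  have y: "G (y_val s y) = y_val ?t y" "y_val ?t' y = G (y_val s' y)" if "y \<in> set (y_vars P)" for y
    using G(2)[OF InlI_yterms] c'(4)[OF InlI_yterms] that by simp_all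
  have ar: "array_val ?t a (x_val ?t x) = Some (G (the (array_val s a (x_val s x))))"
    "array_val ?t' a (x_val ?t' x) = Some (G (the (array_val s' a (x_val s' x))))"
    if "a \<in> set (arrays P)" "x \<in> ?X" for a x
    unfolding yval_dec G(2)[OF InrI_yterms[OF that], symmetric] c'(4)[OF InrI_yterms[OF that]]
    by simp_all
  \<comment> \<open>\<open>F\<close> is injective on old and new values together, so comparisons
    across the step agree as well, such as a new index with a written one.\<close>
  have same_x: "x_val ?t x = x_val ?t' x' \<longleftrightarrow> x_val s x = x_val s' x'" if "x \<in> ?X" "x' \<in> ?X" for x x'
    using F(1) that by (simp add: F(2)[symmetric] c'(3) inj_on_eq_iff)
  have "beval ?t e" using e similar_beval[OF sim wfI(1)] by simp
  moreover have "step_bool P (set I) ?t ?t'"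
    unfolding step_bool_def
  proof (intro ballI conjI allI impI)
    fix b e' assume b: "b \<in> set (bool_vars P)" "AssignB b e' \<in> set I"
    then have "bool_val s' b = beval s e'" "wf_bexp P e'"
      using steps(1) wfI(2) unfolding step_bool_def by force+
    then show "bool_val ?t' b = beval ?t e'"
      using b c'(2) similar_beval[OF sim] by simp
  next
    fix b assume b: "b \<in> set (bool_vars P)" "\<nexists>e. AssignB b e \<in> set I"
    then show "bool_val ?t' b = bool_val ?t b"
      using steps(1) c'(2) sim unfolding step_bool_def similar_def by auto
  qed
  moreover have "step_x P (set I) ?t ?t'"
    unfolding step_x_def
  proof (intro ballI conjI allI impI)
    fix z z' assume "z \<in> ?X" "CopyX z z' \<in> set I"
    moreover from this have "z' \<in> ?X" using wfI(2) by force
    ultimately show "x_val ?t' z = x_val ?t z'"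
      using steps(2) same_x[of z' z] unfolding step_x_def by metis
  next
    fix z assume z: "z \<in> ?X" "\<nexists>z'. CopyX z z' \<in> set I"
    then show "ChooseX z \<in> set I \<or> x_val ?t' z = x_val ?t z"
      using steps(2) same_x[of z z] unfolding step_x_def by metis
  qed
  moreover have "step_y P (set I) ?t ?t'"
    unfolding step_y_def
  proof (intro ballI conjI allI impI)
    fix z z' assume "z \<in> set (y_vars P)" "CopyY z z' \<in> set I"
    moreover from this have "z' \<in> set (y_vars P)" using wfI(2) by force
    ultimately show "y_val ?t' z = y_val ?t z'"
      using steps(3) y unfolding step_y_def by metis
  next
    fix z a x assume z: "z \<in> set (y_vars P)" "Read z a x \<in> set I"
    moreover from this have ax: "a \<in> set (arrays P)" "x \<in> ?X" using wfI(2) by force+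
    moreover have "Some (y_val s' z) = array_val s a (x_val s x)"
      using steps(3) z unfolding step_y_def by blast
    ultimately show "Some (y_val ?t' z) = array_val ?t a (x_val ?t x)"
      using y(2) ar(1)[OF ax] by (metis option.sel)
  next
    fix z assume z: "z \<in> set (y_vars P)" "(\<nexists>z'. CopyY z z' \<in> set I) \<and> (\<nexists>a x. Read z a x \<in> set I)"
    then show "ChooseY z \<in> set I \<or> y_val ?t' z = y_val ?t z"
      using steps(3) y unfolding step_y_def by metis
  qed
  moreover have "step_row P (set I) ?t ?t'"
    unfolding step_row_def
  proof (intro ballI conjI allI impI)
    fix a x' x y' assume *: "a \<in> set (arrays P)" "x' \<in> ?X"
      "Write a x y' \<in> set I \<and> x_val ?t x = x_val ?t' x'"
    then have xy: "x \<in> ?X" "y' \<in> set (y_vars P)" using wfI(2) by force+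
    then have "x_val s x = x_val s' x'" using * same_x by blast
    then have "array_val s' a (x_val s' x') = Some (y_val s y')"
      using steps(4) * program_statesD(1)[OF s'_in] unfolding step_array_def by blast
    then show "array_val ?t' a (x_val ?t' x') = Some (y_val ?t y')"
      using ar(2)[OF *(1,2)] y(1)[OF xy(2)] by simp
  next
    fix a x' assume *: "a \<in> set (arrays P)" "x' \<in> ?X"
      "\<nexists>x y. Write a x y \<in> set I \<and> x_val ?t x = x_val ?t' x'"
      "\<exists>x\<in>?X. x_val ?t x = x_val ?t' x'"
    then obtain x where x: "x \<in> ?X" "x_val ?t x = x_val ?t' x'" "x_val s x = x_val s' x'"
      using same_x by blast
    have "\<nexists>x y. Write a x y \<in> set I \<and> x_val s x = x_val s' x'"
    proof clarify
      fix z y assume w: "Write a z y \<in> set I" "x_val s z = x_val s' x'"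
      then have "z \<in> ?X" using wfI(2) by force
      then show False using w * same_x by blast
    qed
    \<comment> \<open>The index is an old X-value, where every array of a state is defined; hence
      the exemption for \<open>x := ?\<close> in \<open>step_array\<close> does not apply.\<close>
    moreover have "array_val s a (x_val s' x') \<noteq> None"
      using program_statesD(6)[OF s *(1) x(1)] x(3) by auto
    ultimately have "array_val s' a (x_val s' x') = array_val s a (x_val s x)"
      using steps(4) * program_statesD(1)[OF s'_in] x(3) unfolding step_array_def by metis
    then show "array_val ?t' a (x_val ?t' x') = array_val ?t a (x_val ?t' x')"
      using ar[OF *(1)] *(2) x(1,2) by metis
  qed
  ultimately show ?thesis
    using cmd c'(1) sim' unfolding symbolic_step_def by blast
qed

text \<open>The arrays of the successor are dictated by \<open>dec c'\<close> at the new X-values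
  and are the old arrays after the writes elsewhere. The work lies in showing that both
  prescriptions obey \<open>step_array\<close>.\<close>

lemma symbolic_step_back:
  assumes inf: "infinite A" "infinite B" and s: "s \<in> program_states P A B"
    and step: "symbolic_step P (dec c) (dec c')" and sim: "similar P s (dec c)"
  shows "\<exists>s'\<in>succs (program_ts P A B) s. similar P s' (dec c')"
proof -
  let ?X = "set (x_vars P)" and ?t = "dec c" and ?t' = "dec c'"
  from step obtain e I where cmd: "(e, I) \<in> set (commands P)"
    and e: "beval ?t e" and steps: "step_bool P (set I) ?t ?t'" "step_x P (set I) ?t ?t'"
    "step_y P (set I) ?t ?t'" "step_row P (set I) ?t ?t'"
    unfolding symbolic_step_def by blast
  have wfI: "wf_bexp P e" "\<And>i. i \<in> set I \<Longrightarrow> wf_assignment P i"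
    "\<And>i j. i \<in> set I \<Longrightarrow> j \<in> set I \<Longrightarrow> target_of i = target_of j \<Longrightarrow> i = j"
    using wf cmd unfolding wf_program_def by blast+
  \<comment> \<open>Fresh X-values have to avoid the array domains too; the set to be avoided is
    finite because these domains are.\<close>
  let ?old = "x_val s ` ?X \<union> (\<Union>a\<in>set (arrays P). dom (array_val s a))"
  have "infinite (A - ?old)"
    using inf(1) program_statesD(3)[OF s] by (intro Diff_infinite_finite) auto
  then obtain F where F: "inj_on F (x_val ?t ` ?X \<union> x_val ?t' ` ?X)"
    "\<And>x. x \<in> ?X \<Longrightarrow> F (x_val ?t x) = x_val s x"
    "\<And>x. x \<in> ?X \<Longrightarrow> x_val ?t' x \<notin> x_val ?t ` ?X \<Longrightarrow> F (x_val ?t' x) \<in> A - ?old"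
    using extend_matching[of ?X "x_val ?t" "x_val s" ?X "A - ?old" "x_val ?t'"] sim
    unfolding similar_def by blast
  have "infinite (B - yval s ` yterms P)"
    using inf(2) finite_yterms by (intro Diff_infinite_finite) auto
  then obtain G where G: "inj_on G (yval ?t ` yterms P \<union> yval ?t' ` yterms P)"
    "\<And>i. i \<in> yterms P \<Longrightarrow> G (yval ?t i) = yval s i"
    "\<And>i. i \<in> yterms P \<Longrightarrow> yval ?t' i \<notin> yval ?t ` yterms P \<Longrightarrow>
      G (yval ?t' i) \<in> B - yval s ` yterms P"
    using extend_matching[of "yterms P" "yval ?t" "yval s" "yterms P" "B - yval s ` yterms P"
        "yval ?t'"] sim finite_yterms[of P]
    unfolding similar_def by blast
  have FA: "F (x_val ?t' x) \<in> A" if "x \<in> ?X" for x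
    using F(3)[of x] F(2) that program_statesD(1)[OF s] by (cases "x_val ?t' x \<in> x_val ?t ` ?X") force+
  have GB: "G (yval ?t' i) \<in> B" if "i \<in> yterms P" for i
    using G(3)[OF that] G(2) yval_in[OF s] by (cases "yval ?t' i \<in> yval ?t ` yterms P") force+
  define m where "m a v = (if \<exists>x y. Write a x y \<in> set I \<and> x_val s x = v
    then Some (y_val s (SOME y. \<exists>x. Write a x y \<in> set I)) else array_val s a v)" for a v
  have m_write: "m a (x_val s x) = Some (y_val s y)" if "Write a x y \<in> set I" for a x y
  proof -
    \<comment> \<open>Well-formedness admits one write per array, so the choice in \<open>m\<close>
      returns the \<open>y\<close> of that write.\<close>
    have "(\<exists>x. Write a x y' \<in> set I) \<longleftrightarrow> y' = y" for y'
      using wfI(3)[OF that] that by force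
    then show ?thesis using that unfolding m_def by auto
  qed
  have m_other: "m a v = array_val s a v" if "\<nexists>x y. Write a x y \<in> set I \<and> x_val s x = v" for a v
    unfolding m_def using that by (rule if_not_P)
  have dom: "dom (m a) \<subseteq> x_val s ` ?X \<union> dom (array_val s a)" for a
    using wfI(2) by (force simp: m_def split: if_splits)
  have "finite (dom (m a))" "dom (m a) \<subseteq> A" "ran (m a) \<subseteq> B" if "a \<in> set (arrays P)" for a
  proof -
    show "finite (dom (m a))"
      using program_statesD(3)[OF s that] by (intro finite_subset[OF dom]) simp
    show "dom (m a) \<subseteq> A"
      using dom program_statesD(1,4)[OF s] that by blast
    show "ran (m a) \<subseteq> B"
    proof
      fix w assume "w \<in> ran (m a)"
      then obtain v where v: "m a v = Some w" by (auto simp: ran_def)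
      show "w \<in> B"
      proof (cases "\<exists>x y. Write a x y \<in> set I \<and> x_val s x = v")
        case True
        then obtain x y where xy: "Write a x y \<in> set I" "x_val s x = v" by blast
        then have "y \<in> set (y_vars P)" using wfI(2) by force
        then show ?thesis using m_write[OF xy(1)] v xy(2) program_statesD(2)[OF s] by simp
      next
        case False
        then have "array_val s a v = Some w"
          using v m_other[OF False] by simp
        then show ?thesis
          using program_statesD(5)[OF s that] by (meson ranI subsetD)
      qed
    qed
  qed
  note m = this
  have inj: "inj_on F (x_val ?t' ` ?X)" "inj_on G (yval ?t' ` yterms P)"
    using F(1) G(1) by (auto intro: inj_on_subset)
  show ?thesis
  proof (rule realize_concrete[where F = F and G = G and A = A and B = B and c = c' and m = m])
    fix s' assume s': "s' \<in> program_states P A B"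
      "\<And>b. b \<in> set (bool_vars P) \<Longrightarrow> bool_val s' b = bool_val ?t' b"
      "\<And>x. x \<in> ?X \<Longrightarrow> x_val s' x = F (x_val ?t' x)"
      "\<And>i. i \<in> yterms P \<Longrightarrow> yval s' i = G (yval ?t' i)"
      "\<And>a v. a \<in> set (arrays P) \<Longrightarrow> v \<notin> x_val s' ` ?X \<Longrightarrow> array_val s' a v = m a v"
    have sim': "similar P s' ?t'"
      using s'(2-4) inj by (intro similar_sym[OF similarI[of P ?t' s' F G]]) auto
    have y: "y_val s y = G (y_val ?t y)" "y_val s' y = G (y_val ?t' y)" if "y \<in> set (y_vars P)" for y
      using G(2)[OF InlI_yterms] s'(4)[OF InlI_yterms] that by simp_all
    have ar: "array_val s a (x_val s x) = Some (G (the (array_val ?t a (x_val ?t x))))"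
      "array_val s' a (x_val s' x) = Some (G (the (array_val ?t' a (x_val ?t' x))))"
      if "a \<in> set (arrays P)" "x \<in> ?X" for a x
      unfolding array_val_yval[OF s that] array_val_yval[OF s'(1) that]
        G(2)[OF InrI_yterms[OF that], symmetric] s'(4)[OF InrI_yterms[OF that]]
      by simp_all
    have same_x: "x_val s x = x_val s' x' \<longleftrightarrow> x_val ?t x = x_val ?t' x'" if "x \<in> ?X" "x' \<in> ?X" for x x'
      using F(1) that by (simp add: F(2)[symmetric] s'(3) inj_on_eq_iff)
    have "beval s e" using e similar_beval[OF sim wfI(1)] by simp
    moreover have "step_bool P (set I) s s'"
      unfolding step_bool_def
    proof (intro ballI conjI allI impI)
      fix b e' assume b: "b \<in> set (bool_vars P)" "AssignB b e' \<in> set I"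
      then have "bool_val ?t' b = beval ?t e'" "wf_bexp P e'"
        using steps(1) wfI(2) unfolding step_bool_def by force+
      then show "bool_val s' b = beval s e'"
        using b s'(2) similar_beval[OF sim] by simp
    next
      fix b assume b: "b \<in> set (bool_vars P)" "\<nexists>e. AssignB b e \<in> set I"
      then show "bool_val s' b = bool_val s b"
        using steps(1) s'(2) sim unfolding step_bool_def similar_def by auto
    qed
    moreover have "step_x P (set I) s s'"
      unfolding step_x_def
    proof (intro ballI conjI allI impI)
      fix z z' assume "z \<in> ?X" "CopyX z z' \<in> set I"
      moreover from this have "z' \<in> ?X" using wfI(2) by force
      ultimately show "x_val s' z = x_val s z'"
        using steps(2) same_x[of z' z] unfolding step_x_def by metis
    next
      fix z assume z: "z \<in> ?X" "\<nexists>z'. CopyX z z' \<in> set I"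
      then show "ChooseX z \<in> set I \<or> x_val s' z = x_val s z"
        using steps(2) same_x[of z z] unfolding step_x_def by metis
    qed
    moreover have "step_y P (set I) s s'"
      unfolding step_y_def
    proof (intro ballI conjI allI impI)
      fix z z' assume "z \<in> set (y_vars P)" "CopyY z z' \<in> set I"
      moreover from this have "z' \<in> set (y_vars P)" using wfI(2) by force
      ultimately show "y_val s' z = y_val s z'"
        using steps(3) y unfolding step_y_def by metis
    next
      fix z a x assume z: "z \<in> set (y_vars P)" "Read z a x \<in> set I"
      moreover from this have ax: "a \<in> set (arrays P)" "x \<in> ?X" using wfI(2) by force+
      moreover have "Some (y_val ?t' z) = array_val ?t a (x_val ?t x)"
        using steps(3) z unfolding step_y_def by blast
      ultimately show "Some (y_val s' z) = array_val s a (x_val s x)"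
        using y(2) ar(1)[OF ax] by (metis option.sel)
    next
      fix z assume z: "z \<in> set (y_vars P)" "(\<nexists>z'. CopyY z z' \<in> set I) \<and> (\<nexists>a x. Read z a x \<in> set I)"
      then show "ChooseY z \<in> set I \<or> y_val s' z = y_val s z"
        using steps(3) y unfolding step_y_def by metis
    qed
    moreover have "step_array P A (set I) s s'"
      unfolding step_array_def
    proof (intro ballI conjI allI impI)
      fix a v x y' assume *: "a \<in> set (arrays P)" "v \<in> A" "Write a x y' \<in> set I \<and> x_val s x = v"
      then have xy: "x \<in> ?X" "y' \<in> set (y_vars P)" using wfI(2) by force+
      show "array_val s' a v = Some (y_val s y')"
      proof (cases "v \<in> x_val s' ` ?X")
        case True
        then obtain x' where x': "x' \<in> ?X" "v = x_val s' x'" by blast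
        then have "array_val ?t' a (x_val ?t' x') = Some (y_val ?t y')"
          using steps(4) * same_x[OF xy(1)] unfolding step_row_def by blast
        then show ?thesis
          using ar(2)[OF *(1) x'(1)] x'(2) y(1)[OF xy(2)] by simp
      next
        case False
        then show ?thesis using s'(5)[OF *(1)] m_write * by metis
      qed
    next
      fix a v assume *: "a \<in> set (arrays P)" "v \<in> A" "\<nexists>x y. Write a x y \<in> set I \<and> x_val s x = v"
        "\<nexists>x. x \<in> ?X \<and> ChooseX x \<in> set I \<and> x_val s' x = v \<and> array_val s a v = None"
      show "array_val s' a v = array_val s a v"
      proof (cases "v \<in> x_val s' ` ?X")
        case False
        then show ?thesis using s'(5)[OF *(1)] m_other[OF *(3)] by simp
      next
        case True
        then obtain x' where x': "x' \<in> ?X" "v = x_val s' x'" by blast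
        show ?thesis
        proof (cases "\<exists>x\<in>?X. x_val ?t x = x_val ?t' x'")
          case True
          then obtain x where x: "x \<in> ?X" "x_val ?t x = x_val ?t' x'" "x_val s x = v"
            using same_x x' by blast
          have "\<nexists>x y. Write a x y \<in> set I \<and> x_val ?t x = x_val ?t' x'"
          proof clarify
            fix z y assume w: "Write a z y \<in> set I" "x_val ?t z = x_val ?t' x'"
            then have "z \<in> ?X" using wfI(2) by force
            then show False using w * x' same_x by blast
          qed
          then have "array_val ?t' a (x_val ?t' x') = array_val ?t a (x_val ?t x)"
            using steps(4) *(1) x'(1) x(1,2) unfolding step_row_def by metis
          then show ?thesis
            using ar(1)[OF *(1) x(1)] ar(2)[OF *(1) x'(1)] x(3) x'(2) by simp
        next
          case False
          \<comment> \<open>A value not seen before is fresh, so the array is undefined there. If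
            \<open>x'\<close> were chosen, the exemption excluded by the assumption would apply;
            hence \<open>x'\<close> is copied or unchanged and its value is old after all, a
            contradiction.\<close>
          then have "x_val ?t' x' \<notin> x_val ?t ` ?X" by fastforce
          then have "v \<in> A - ?old"
            unfolding x'(2) s'(3)[OF x'(1)] by (rule F(3)[OF x'(1)])
          then have "v \<notin> dom (array_val s a)"
            using *(1) by blast
          then have "ChooseX x' \<notin> set I" using *(4) x' by auto
          moreover have "x_val ?t' x' = x_val ?t z" if "CopyX x' z \<in> set I" for z
            using steps(2) x'(1) that unfolding step_x_def by blast
          moreover have "z \<in> ?X" if "CopyX x' z \<in> set I" for z
            using wfI(2)[OF that] by simp
          ultimately show ?thesis
            using steps(2) x'(1) False unfolding step_x_def by metis
        qed
      qed
    qed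
    ultimately have "s' \<in> succs (program_ts P A B) s"
      using s'(1) cmd unfolding program_ts_def by auto
    then show ?thesis using sim' by blast
  qed (use inj(1) FA GB m in auto)
qed

lemma bisimulation_symbolic:
  assumes "infinite A" "infinite B"
  shows "bisimulation (program_ts P A B) symbolic_ts (set (bool_vars P))
    (\<lambda>s c. s \<in> program_states P A B \<and> c < M \<and> similar P s (dec c))"
proof -
  have st: "states (program_ts P A B) = program_states P A B" "states symbolic_ts = {..<M}"
    "ext (program_ts P A B) b \<subseteq> program_states P A B" "ext symbolic_ts b \<subseteq> {..<M}" for b
    by (auto simp: program_ts_def symbolic_ts_def)
  have sub: "succs (program_ts P A B) s \<subseteq> program_states P A B" for s
    by (auto simp: program_ts_def)
  have suc: "c' \<in> succs symbolic_ts c \<longleftrightarrow> c' < M \<and> symbolic_step P (dec c) (dec c')" for c c'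
    by (simp add: symbolic_ts_def)
  show ?thesis
    unfolding bisimulation_def st
  proof (intro conjI allI ballI impI)
    fix s :: "('a, 'b) state" and c s' c'
    assume R: "s \<in> program_states P A B \<and> c < M \<and> similar P s (dec c)"
    then show "\<exists>c'\<in>succs symbolic_ts c. s' \<in> program_states P A B \<and> c' < M \<and> similar P s' (dec c')"
      if "s' \<in> succs (program_ts P A B) s"
      using symbolic_step_forth[of s A B s' c] that sub[of s] suc by blast
    show "\<exists>s'\<in>succs (program_ts P A B) s. s' \<in> program_states P A B \<and> c' < M \<and> similar P s' (dec c')"
      if "c' \<in> succs symbolic_ts c"
      using symbolic_step_back[OF assms, of s c c'] R that sub[of s] suc by blast
    show "s \<in> ext (program_ts P A B) p \<longleftrightarrow> c \<in> ext symbolic_ts p" if "p \<in> set (bool_vars P)" for p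
      using R that by (auto simp: program_ts_def symbolic_ts_def similar_def)
  next
    fix s s' :: "('a, 'b) state" and c c'
    assume "s \<in> program_states P A B \<and> c < M \<and> similar P s (dec c)"
      "s' \<in> program_states P A B \<and> c < M \<and> similar P s' (dec c)"
      "s' \<in> program_states P A B \<and> c' < M \<and> similar P s' (dec c')"
    then show "similar P s (dec c')"
      by (meson similar_sym similar_trans)
  next
    fix c assume "c \<in> {..<M}"
    then show "\<exists>s. s \<in> program_states P A B \<and> c < M \<and> similar P s (dec c)"
      using concrete_total[OF assms, of c] by blast
  qed (use st symbolic_total in auto)
qed

text \<open>The right-hand side mentions neither carrier, and the empty environment stands for all
  of them because the formula is closed.\<close>

lemma mc_holds_symbolic:
  assumes "infinite A" "infinite B" "b \<in> set (bool_vars P)" "closed_formula \<phi>"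
    "formula_obs \<phi> \<subseteq> set (bool_vars P)"
  shows "mc_holds A B (P, b, \<phi>) \<longleftrightarrow>
    (\<forall>c<M. bool_val (dec c) b \<longrightarrow> c \<in> mu_sem symbolic_ts \<phi> (\<lambda>_. {}))"
proof -
  note bis = bisimulation_symbolic[OF assms(1,2)]
  let ?C = "program_ts P A B"
  have st: "states ?C = program_states P A B" "s \<in> ext ?C b \<longleftrightarrow> s \<in> program_states P A B \<and> bool_val s b"
    for s by (auto simp: program_ts_def)
  have "s \<in> mu_sem ?C \<phi> E \<longleftrightarrow> c \<in> mu_sem symbolic_ts \<phi> (\<lambda>_. {})"
    if "\<And>h. E h \<subseteq> states ?C" "s \<in> program_states P A B" "c < M" "similar P s (dec c)" for s c E
    using assms(4) that by (intro bisimulation_mu_sem[OF bis assms(5)]) (auto simp: closed_formula_def)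
  then have *: "sat ?C s \<phi> \<longleftrightarrow> c \<in> mu_sem symbolic_ts \<phi> (\<lambda>_. {})"
    if "s \<in> program_states P A B" "c < M" "similar P s (dec c)" for s c
    \<comment> \<open>The empty environment is admissible, so the quantifier over environments in
      \<open>sat\<close> is not vacuous.\<close>
    using that unfolding sat_def by (metis empty_subsetI)
  have b: "bool_val s b \<longleftrightarrow> bool_val (dec c) b" if "similar P s (dec c)" for s :: "('a, 'b) state" and c
    using that assms(3) unfolding similar_def by blast
  show ?thesis
    unfolding mc_holds_def sat_from_def prod.case
  proof (intro iffI allI impI ballI)
    fix c assume "\<forall>s\<in>ext ?C b. sat ?C s \<phi>" "c < M" "bool_val (dec c) b"
    then show "c \<in> mu_sem symbolic_ts \<phi> (\<lambda>_. {})"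
      using concrete_total[OF assms(1,2), of c] * b st(2) by blast
  next
    fix s assume "\<forall>c<M. bool_val (dec c) b \<longrightarrow> c \<in> mu_sem symbolic_ts \<phi> (\<lambda>_. {})" "s \<in> ext ?C b"
    then show "sat ?C s \<phi>"
      using symbolic_total[of s A B] * b st(2) by blast
  qed
qed

end

section \<open>The decision procedure on codes\<close>

declare list_encode.simps [simp del]

section \<open>Symbolic states as digit strings\<close>

definition digit :: "nat \<Rightarrow> nat \<Rightarrow> nat \<Rightarrow> nat" where
  "digit L c k = c div L ^ k mod L"

text \<open>The new digit goes on top; it adds a multiple of a higher power of \<open>L\<close>,
  which leaves the lower digits alone.\<close>

lemma digits_exist:
  assumes "\<And>k. k < n \<Longrightarrow> f k < L"
  shows "\<exists>c<L ^ n. \<forall>k<n. digit L c k = f k"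
  using assms
proof (induction n)
  case (Suc n)
  then obtain c where c: "c < L ^ n" "\<And>k. k < n \<Longrightarrow> digit L c k = f k" by force
  have fn: "f n < L" using Suc.prems by simp
  define c' where "c' = c + f n * L ^ n"
  have "c' < Suc (f n) * L ^ n" using c(1) by (simp add: c'_def)
  also have "\<dots> \<le> L ^ Suc n" unfolding power_Suc using fn by (intro mult_le_mono1) simp
  finally have "c' < L ^ Suc n" .
  moreover have "digit L c' k = f k" if "k < Suc n" for k
  proof (cases "k = n")
    case True
    then show ?thesis using c(1) fn by (simp add: digit_def c'_def)
  next
    case False
    then have "k < n" using that by simp
    then obtain j where n: "n = k + Suc j" by (metis add_Suc_right less_imp_Suc_add)
    have "L ^ k \<noteq> 0" using fn by simp
    have "L ^ n = L ^ k * (L * L ^ j)" by (simp add: n power_add)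
    then have "c' = c + (L * (f n * L ^ j)) * L ^ k"
      unfolding c'_def by (simp only: ac_simps)
    then have "c' div L ^ k = L * (f n * L ^ j) + c div L ^ k"
      by (simp only: div_mult_self1[OF \<open>L ^ k \<noteq> 0\<close>])
    then have "digit L c' k = digit L c k" by (simp add: digit_def)
    then show ?thesis using c(2) False that by simp
  qed
  ultimately show ?case by blast
qed simp

text \<open>Each variable and each array cell owns one digit position, a pair of tag and name: tags
  0, 1, 2 for the scalar types and \<open>a + 3\<close> for array \<open>a\<close>, whose cells are
  named by their index. Every number decodes to a state, digits other than 1 counting as
  false.\<close>

definition dec_state :: "nat \<Rightarrow> nat \<Rightarrow> (nat, nat) state" where
  "dec_state L c = \<lparr>bool_val = (\<lambda>b. digit L c (prod_encode (0, b)) = 1),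
    x_val = (\<lambda>x. digit L c (prod_encode (1, x))),
    y_val = (\<lambda>y. digit L c (prod_encode (2, y))),
    array_val = (\<lambda>a v. Some (digit L c (prod_encode (a + 3, v))))\<rparr>"

text \<open>With at most \<open>c\<close> variables of each kind there are at most
  \<open>c + c * c\<close> Y-terms; the factor 2 leaves room for fresh values. The summand 2 lets
  the boolean digits 0 and 1 fit for every \<open>c\<close>.\<close>

definition value_bound :: "nat \<Rightarrow> nat" where
  "value_bound c = 2 * (c + c * c) + 2"

text \<open>The exponent exceeds every digit position in use: tags stay below \<open>c + 3\<close>,
  names and array indices below \<open>value_bound c\<close>.\<close>

definition state_bound :: "nat \<Rightarrow> nat" where
  "state_bound c = value_bound c ^ prod_encode (c + 3, value_bound c)"

lemma program_code_code_nth: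
  "code_nth (program_code P) 0 = list_encode (bool_vars P)"
  "code_nth (program_code P) 1 = list_encode (x_vars P)"
  "code_nth (program_code P) 2 = list_encode (y_vars P)"
  "code_nth (program_code P) 3 = list_encode (arrays P)"
  "code_nth (program_code P) 4 = list_encode (map command_code (commands P))"
  by (simp_all add: program_code_def code_nth_list_encode)

lemma program_code_less:
  "list_encode (bool_vars P) < program_code P" "list_encode (x_vars P) < program_code P"
  "list_encode (y_vars P) < program_code P" "list_encode (arrays P) < program_code P"
  "list_encode (map command_code (commands P)) < program_code P"
  unfolding program_code_def by (auto intro!: member_less_list_encode)

lemma symbolic_dec_state:
  assumes "wf_program P" and c: "program_code P < c"
  shows "symbolic P (value_bound c) (state_bound c) (dec_state (value_bound c))"
proof
  let ?L = "value_bound c"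
  have card: "card (set xs) \<le> c" "\<And>x. x \<in> set xs \<Longrightarrow> x < c" if "list_encode xs < program_code P" for xs
    using card_length[of xs] length_le_list_encode[of xs] member_less_list_encode[of _ xs] that c
    by (linarith, fastforce)
  note card = card[OF program_code_less(1)] card[OF program_code_less(2)]
    card[OF program_code_less(3)] card[OF program_code_less(4)]
  show "wf_program P" by fact
  show "2 * card (set (x_vars P)) \<le> ?L" using card by (simp add: value_bound_def)
  have "card (yterms P) \<le> card (set (y_vars P)) + card (set (arrays P)) * card (set (x_vars P))"
    unfolding yterms_def card_cartesian_product[symmetric]
    by (rule order_trans[OF card_Un_le add_mono[OF card_image_le card_image_le]]) simp_all
  also have "\<dots> \<le> c + c * c" using card by (intro add_mono mult_mono) auto
  finally show "2 * card (yterms P) \<le> ?L" by (simp add: value_bound_def)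
  show L: "0 < ?L" by (simp add: value_bound_def)
  then show "x_val (dec_state ?L n) x < ?L" "y_val (dec_state ?L n) y < ?L"
    "\<exists>w<?L. array_val (dec_state ?L n) a v = Some w" for n x y a v
    by (simp_all add: dec_state_def digit_def)
  fix bv :: "nat \<Rightarrow> bool" and xv yv :: "nat \<Rightarrow> nat" and av :: "nat \<Rightarrow> nat \<Rightarrow> nat"
  assume b: "\<And>x. xv x < ?L" "\<And>y. yv y < ?L" "\<And>a v. av a v < ?L"
  \<comment> \<open>The digit wanted at position \<open>k\<close>, looked up by the tag and name
    packed into \<open>k\<close>.\<close>
  define f where "f k = (let (t, z) = prod_decode k in
    if t = 0 then (if bv z then 1 else 0) else if t = 1 then xv z else if t = 2 then yv z
    else av (t - 3) z)" for k
  have "f k < ?L" for k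
    using b by (auto simp: f_def Let_def value_bound_def split: prod.split)
  then obtain n where n: "n < state_bound c"
    "\<And>k. k < prod_encode (c + 3, ?L) \<Longrightarrow> digit ?L n k = f k"
    using digits_exist[of "prod_encode (c + 3, ?L)" f ?L] unfolding state_bound_def by blast
  have "c < ?L" by (simp add: value_bound_def)
  then have "bool_val (dec_state ?L n) z = bv z" "x_val (dec_state ?L n) z = xv z"
    "y_val (dec_state ?L n) z = yv z" if "z < c" for z
    using that by (simp_all add: dec_state_def n(2) prod_encode_less f_def)
  moreover have "array_val (dec_state ?L n) a v = Some (av a v)" if "a < c" "v < ?L" for a v
    using that by (simp add: dec_state_def n(2) prod_encode_less f_def)
  ultimately show "\<exists>n<state_bound c. (\<forall>b\<in>set (bool_vars P). bool_val (dec_state ?L n) b = bv b) \<and>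
        (\<forall>x\<in>set (x_vars P). x_val (dec_state ?L n) x = xv x) \<and>
        (\<forall>y\<in>set (y_vars P). y_val (dec_state ?L n) y = yv y) \<and>
        (\<forall>a\<in>set (arrays P). \<forall>v<?L. array_val (dec_state ?L n) a v = Some (av a v))"
    using n(1) card by blast
qed

section \<open>Boolean expressions on codes\<close>

text \<open>One unfolding of \<open>beval\<close>, with the mask \<open>W\<close> answering for
  subexpressions. Tag 1, the constant false, rightly has no disjunct.\<close>

definition bexp_cond :: "nat \<Rightarrow> nat \<Rightarrow> nat \<Rightarrow> nat \<Rightarrow> bool" where
  "bexp_cond L s W t \<longleftrightarrow> code_nth t 0 = 0 \<or>
    code_nth t 0 = 2 \<and> bool_val (dec_state L s) (code_nth t 1) \<or>
    code_nth t 0 = 3 \<and> x_val (dec_state L s) (code_nth t 1) = x_val (dec_state L s) (code_nth t 2) \<or>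
    code_nth t 0 = 4 \<and> y_val (dec_state L s) (code_nth t 1) = y_val (dec_state L s) (code_nth t 2) \<or>
    code_nth t 0 = 5 \<and> code_nth t 1 \<notin> set_decode W \<or>
    code_nth t 0 = 6 \<and> (code_nth t 1 \<in> set_decode W \<or> code_nth t 2 \<in> set_decode W)"

definition bexp_stage :: "nat \<Rightarrow> nat \<Rightarrow> nat \<Rightarrow> nat \<Rightarrow> nat" where
  "bexp_stage c L s d = rec_nat 0 (\<lambda>_ W. set_encode {t. t < c \<and> bexp_cond L s W t}) d"

definition bexp_holds :: "nat \<Rightarrow> nat \<Rightarrow> nat \<Rightarrow> nat \<Rightarrow> bool" where
  "bexp_holds c L s t \<longleftrightarrow> t \<in> set_decode (bexp_stage c L s c)"

lemma set_decode_bexp_stage: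
  "t \<in> set_decode (bexp_stage c L s (Suc d)) \<longleftrightarrow> t < c \<and> bexp_cond L s (bexp_stage c L s d) t"
  by (simp add: bexp_stage_def)

text \<open>Round \<open>d\<close> is right on codes below \<open>d\<close>, since subexpressions
  have smaller codes and were settled a round earlier. Because of negation the rounds need not
  increase, so nothing is claimed about larger codes.\<close>

lemma bexp_stage_correct:
  "bexp_code e < d \<Longrightarrow> bexp_code e < c \<Longrightarrow>
    bexp_code e \<in> set_decode (bexp_stage c L s d) \<longleftrightarrow> beval (dec_state L s) e"
proof (induction e arbitrary: d)
  case (BNot e)
  obtain d' where d: "d = Suc d'" using BNot.prems by (cases d) auto
  have "bexp_code e < bexp_code (BNot e)" by (auto intro: member_less_list_encode)
  then have "bexp_code e \<in> set_decode (bexp_stage c L s d') \<longleftrightarrow> beval (dec_state L s) e"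
    using BNot.prems d by (intro BNot.IH) linarith+
  then show ?case
    using BNot.prems unfolding d set_decode_bexp_stage bexp_cond_def by (simp add: code_nth_list_encode)
next
  case (BOr e1 e2)
  obtain d' where d: "d = Suc d'" using BOr.prems by (cases d) auto
  have "bexp_code e1 < bexp_code (BOr e1 e2)" "bexp_code e2 < bexp_code (BOr e1 e2)"
    by (auto intro: member_less_list_encode)
  then have "bexp_code e1 \<in> set_decode (bexp_stage c L s d') \<longleftrightarrow> beval (dec_state L s) e1"
    "bexp_code e2 \<in> set_decode (bexp_stage c L s d') \<longleftrightarrow> beval (dec_state L s) e2"
    using BOr.prems d by (intro BOr.IH; linarith)+
  then show ?case
    using BOr.prems unfolding d set_decode_bexp_stage bexp_cond_def by (simp add: code_nth_list_encode)
qed (case_tac d; simp add: set_decode_bexp_stage bexp_cond_def code_nth_list_encode)+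

lemma bexp_holds_bexp_code: "bexp_code e < c \<Longrightarrow> bexp_holds c L s (bexp_code e) \<longleftrightarrow> beval (dec_state L s) e"
  unfolding bexp_holds_def by (rule bexp_stage_correct)

section \<open>The step relation on codes\<close>

text \<open>Here \<open>c\<close> codes the whole instance and \<open>I\<close> an assignment list.
  In this and the following conditions, nonexistence and existence are phrased by bounded universal
  quantifiers, so that a few equivalences translate all of them.\<close>

definition bool_cond :: "nat \<Rightarrow> nat \<Rightarrow> nat \<Rightarrow> nat \<Rightarrow> nat \<Rightarrow> bool" where
  "bool_cond c L I s s' \<longleftrightarrow> (\<forall>b<c. code_mem b (code_nth (code_nth c 0) 0) \<longrightarrow>
    (\<forall>u<c. code_mem (list_encode [0, b, u]) I \<longrightarrow>
      (bool_val (dec_state L s') b \<longleftrightarrow> bexp_holds c L s u)) \<and>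
    ((\<forall>u<c. \<not> code_mem (list_encode [0, b, u]) I) \<longrightarrow>
      (bool_val (dec_state L s') b \<longleftrightarrow> bool_val (dec_state L s) b)))"

definition x_cond :: "nat \<Rightarrow> nat \<Rightarrow> nat \<Rightarrow> nat \<Rightarrow> nat \<Rightarrow> bool" where
  "x_cond c L I s s' \<longleftrightarrow> (\<forall>z<c. code_mem z (code_nth (code_nth c 0) 1) \<longrightarrow>
    (\<forall>u<c. code_mem (list_encode [1, z, u]) I \<longrightarrow> x_val (dec_state L s') z = x_val (dec_state L s) u) \<and>
    ((\<forall>u<c. \<not> code_mem (list_encode [1, z, u]) I) \<longrightarrow>
      code_mem (list_encode [3, z]) I \<or> x_val (dec_state L s') z = x_val (dec_state L s) z))"

definition y_cond :: "nat \<Rightarrow> nat \<Rightarrow> nat \<Rightarrow> nat \<Rightarrow> nat \<Rightarrow> bool" where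
  "y_cond c L I s s' \<longleftrightarrow> (\<forall>z<c. code_mem z (code_nth (code_nth c 0) 2) \<longrightarrow>
    (\<forall>u<c. code_mem (list_encode [2, z, u]) I \<longrightarrow> y_val (dec_state L s') z = y_val (dec_state L s) u) \<and>
    (\<forall>a<c. \<forall>x<c. code_mem (list_encode [5, z, a, x]) I \<longrightarrow>
      y_val (dec_state L s') z = the (array_val (dec_state L s) a (x_val (dec_state L s) x))) \<and>
    ((\<forall>u<c. \<not> code_mem (list_encode [2, z, u]) I) \<and>
     (\<forall>a<c. \<forall>x<c. \<not> code_mem (list_encode [5, z, a, x]) I) \<longrightarrow>
      code_mem (list_encode [4, z]) I \<or> y_val (dec_state L s') z = y_val (dec_state L s) z))"

definition row_cond :: "nat \<Rightarrow> nat \<Rightarrow> nat \<Rightarrow> nat \<Rightarrow> nat \<Rightarrow> bool" where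
  "row_cond c L I s s' \<longleftrightarrow> (\<forall>a<c. code_mem a (code_nth (code_nth c 0) 3) \<longrightarrow>
    (\<forall>z<c. code_mem z (code_nth (code_nth c 0) 1) \<longrightarrow>
      (\<forall>x<c. \<forall>y<c. code_mem (list_encode [6, a, x, y]) I \<longrightarrow>
        x_val (dec_state L s) x = x_val (dec_state L s') z \<longrightarrow>
        the (array_val (dec_state L s') a (x_val (dec_state L s') z)) = y_val (dec_state L s) y) \<and>
      ((\<forall>x<c. \<forall>y<c. code_mem (list_encode [6, a, x, y]) I \<longrightarrow>
        \<not> x_val (dec_state L s) x = x_val (dec_state L s') z) \<longrightarrow>
        \<not> (\<forall>x<c. code_mem x (code_nth (code_nth c 0) 1) \<longrightarrow> \<not> x_val (dec_state L s) x = x_val (dec_state L s') z) \<longrightarrow>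
        the (array_val (dec_state L s') a (x_val (dec_state L s') z)) =
          the (array_val (dec_state L s) a (x_val (dec_state L s') z)))))"

definition step_cond :: "nat \<Rightarrow> nat \<Rightarrow> nat \<Rightarrow> nat \<Rightarrow> bool" where
  "step_cond c L s s' \<longleftrightarrow> \<not> (\<forall>k<c. code_mem k (code_nth (code_nth c 0) 4) \<longrightarrow>
    \<not> (bexp_holds c L s (code_nth k 0) \<and> bool_cond c L (code_nth k 1) s s' \<and> x_cond c L (code_nth k 1) s s' \<and>
      y_cond c L (code_nth k 1) s s' \<and> row_cond c L (code_nth k 1) s s'))"

lemma all_code_mem:
  assumes "list_encode xs < c"
  shows "(\<forall>x<c. code_mem x (list_encode xs) \<longrightarrow> Q x) \<longleftrightarrow> (\<forall>x\<in>set xs. Q x)"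
  using member_less_list_encode[of _ xs] assms by (auto dest: order.strict_trans)

text \<open>The bound \<open>c\<close> cuts nothing off: the components of an assignment in
  \<open>I\<close> are smaller than its code, hence smaller than \<open>J\<close>.\<close>

lemma code_mem_assignments:
  fixes I :: "assignment list"
  defines "J \<equiv> list_encode (map assignment_code I)"
  assumes "J < c"
  shows "(\<forall>u<c. code_mem (list_encode [0, z, u]) J \<longrightarrow> Q u) \<longleftrightarrow> (\<forall>e. AssignB z e \<in> set I \<longrightarrow> Q (bexp_code e))"
    and "(\<forall>u<c. code_mem (list_encode [1, z, u]) J \<longrightarrow> Q u) \<longleftrightarrow> (\<forall>u. CopyX z u \<in> set I \<longrightarrow> Q u)"
    and "(\<forall>u<c. code_mem (list_encode [2, z, u]) J \<longrightarrow> Q u) \<longleftrightarrow> (\<forall>u. CopyY z u \<in> set I \<longrightarrow> Q u)"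
    and "code_mem (list_encode [3, z]) J \<longleftrightarrow> ChooseX z \<in> set I"
    and "code_mem (list_encode [4, z]) J \<longleftrightarrow> ChooseY z \<in> set I"
    and "(\<forall>a<c. \<forall>x<c. code_mem (list_encode [5, z, a, x]) J \<longrightarrow> R a x) \<longleftrightarrow>
      (\<forall>a x. Read z a x \<in> set I \<longrightarrow> R a x)"
    and "(\<forall>x<c. \<forall>y<c. code_mem (list_encode [6, z, x, y]) J \<longrightarrow> R x y) \<longleftrightarrow>
      (\<forall>x y. Write z x y \<in> set I \<longrightarrow> R x y)"
proof -
  have mem: "code_mem u J \<longleftrightarrow> (\<exists>i\<in>set I. u = assignment_code i)" for u
    by (auto simp: J_def)
  have code: "code_mem (assignment_code i) J \<longleftrightarrow> i \<in> set I" for i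
    using inj_assignment_code unfolding mem by (auto dest: injD)
  have less: "v < c" if "code_mem (list_encode xs) J" "v \<in> set xs" for v xs
    using that member_less_list_encode[of v xs]
      member_less_list_encode[of "list_encode xs" "map assignment_code I"] assms(2)
    by (simp add: J_def)
  \<comment> \<open>Only a boolean assignment contains a coded subterm; any \<open>u\<close> found
    in its place has to be recognised as the code of an expression.\<close>
  have 0: "\<exists>e. u = bexp_code e" if "code_mem (list_encode [0, z, u]) J" for u
  proof -
    from that obtain i where "list_encode [0, z, u] = assignment_code i" unfolding mem by blast
    then show ?thesis by (cases i) (auto simp: list_encode_eq)
  qed
  show "(\<forall>u<c. code_mem (list_encode [0, z, u]) J \<longrightarrow> Q u) \<longleftrightarrow> (\<forall>e. AssignB z e \<in> set I \<longrightarrow> Q (bexp_code e))"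
    using 0 less[of "[0, z, _]"] code[of "AssignB z _"] by fastforce
  show "(\<forall>u<c. code_mem (list_encode [1, z, u]) J \<longrightarrow> Q u) \<longleftrightarrow> (\<forall>u. CopyX z u \<in> set I \<longrightarrow> Q u)"
    using less[of "[1, z, _]"] code[of "CopyX z _"] by auto
  show "(\<forall>u<c. code_mem (list_encode [2, z, u]) J \<longrightarrow> Q u) \<longleftrightarrow> (\<forall>u. CopyY z u \<in> set I \<longrightarrow> Q u)"
    using less[of "[2, z, _]"] code[of "CopyY z _"] by auto
  show "code_mem (list_encode [3, z]) J \<longleftrightarrow> ChooseX z \<in> set I"
    using code[of "ChooseX z"] by simp
  show "code_mem (list_encode [4, z]) J \<longleftrightarrow> ChooseY z \<in> set I"
    using code[of "ChooseY z"] by simp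
  show "(\<forall>a<c. \<forall>x<c. code_mem (list_encode [5, z, a, x]) J \<longrightarrow> R a x) \<longleftrightarrow>
      (\<forall>a x. Read z a x \<in> set I \<longrightarrow> R a x)"
    using less[of "[5, z, _, _]"] code[of "Read z _ _"] by auto
  show "(\<forall>x<c. \<forall>y<c. code_mem (list_encode [6, z, x, y]) J \<longrightarrow> R x y) \<longleftrightarrow>
      (\<forall>x y. Write z x y \<in> set I \<longrightarrow> R x y)"
    using less[of "[6, z, _, _]"] code[of "Write z _ _"] by auto
qed

text \<open>Decoded arrays are total, so equations between options reduce to equations between
  numbers.\<close>

lemma array_val_dec_state:
  "Some w = array_val (dec_state L s) a v \<longleftrightarrow> w = the (array_val (dec_state L s) a v)"
  "array_val (dec_state L s) a v = Some w \<longleftrightarrow> the (array_val (dec_state L s) a v) = w"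
  "array_val (dec_state L s) a v = array_val (dec_state L s') a v' \<longleftrightarrow>
    the (array_val (dec_state L s) a v) = the (array_val (dec_state L s') a v')"
  by (auto simp: dec_state_def)

lemma step_cond_iff:
  assumes c: "code_nth c 0 = program_code P" "program_code P < c"
  shows "step_cond c L s s' \<longleftrightarrow> symbolic_step P (dec_state L s) (dec_state L s')"
proof -
  let ?t = "dec_state L s" and ?t' = "dec_state L s'"
  note less = program_code_less[THEN order.strict_trans, OF c(2)]
  have *: "bexp_holds c L s (code_nth (command_code (e, I)) 0) \<longleftrightarrow> beval ?t e"
    "bool_cond c L (code_nth (command_code (e, I)) 1) s s' \<longleftrightarrow> step_bool P (set I) ?t ?t'"
    "x_cond c L (code_nth (command_code (e, I)) 1) s s' \<longleftrightarrow> step_x P (set I) ?t ?t'"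
    "y_cond c L (code_nth (command_code (e, I)) 1) s s' \<longleftrightarrow> step_y P (set I) ?t ?t'"
    "row_cond c L (code_nth (command_code (e, I)) 1) s s' \<longleftrightarrow> step_row P (set I) ?t ?t'"
    if cmd: "(e, I) \<in> set (commands P)" for e I
  proof -
    let ?I = "list_encode (map assignment_code I)"
    have nth: "code_nth (command_code (e, I)) 0 = bexp_code e" "code_nth (command_code (e, I)) 1 = ?I"
      by (simp_all add: command_code_def code_nth_list_encode)
    have "command_code (e, I) < c"
      using member_less_list_encode[of "command_code (e, I)" "map command_code (commands P)"] cmd less(5)
      by (auto intro: order.strict_trans)
    moreover have "bexp_code e < command_code (e, I)" "?I < command_code (e, I)"
      by (auto simp: command_code_def intro: member_less_list_encode)
    ultimately have ec: "bexp_code e < c" and Ic: "?I < c" by linarith+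
    show "bexp_holds c L s (code_nth (command_code (e, I)) 0) \<longleftrightarrow> beval ?t e"
      unfolding nth by (rule bexp_holds_bexp_code[OF ec])
    have e': "bexp_holds c L s (bexp_code e') \<longleftrightarrow> beval ?t e'" if "AssignB b e' \<in> set I" for b e'
    proof (rule bexp_holds_bexp_code)
      have "bexp_code e' < assignment_code (AssignB b e')"
        by (auto intro: member_less_list_encode)
      also have "\<dots> < ?I" using that by (intro member_less_list_encode) force
      finally show "bexp_code e' < c" using Ic by simp
    qed
    note mem = code_mem_assignments[OF Ic]
    \<comment> \<open>With the constantly false predicate the translations express that no such
      assignment occurs.\<close>
    note neg = mem(1,2,3)[where Q = "\<lambda>_. False", unfolded simp_thms]
      mem(6)[where R = "\<lambda>_ _. False", unfolded simp_thms]
    show "bool_cond c L (code_nth (command_code (e, I)) 1) s s' \<longleftrightarrow> step_bool P (set I) ?t ?t'"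
      unfolding bool_cond_def step_bool_def nth mem neg c(1) program_code_code_nth all_code_mem[OF less(1)]
      using e' by auto
    show "x_cond c L (code_nth (command_code (e, I)) 1) s s' \<longleftrightarrow> step_x P (set I) ?t ?t'"
      unfolding x_cond_def step_x_def nth mem neg c(1) program_code_code_nth all_code_mem[OF less(2)]
      by auto
    show "y_cond c L (code_nth (command_code (e, I)) 1) s s' \<longleftrightarrow> step_y P (set I) ?t ?t'"
      unfolding y_cond_def step_y_def nth mem neg c(1) program_code_code_nth all_code_mem[OF less(3)]
        array_val_dec_state
      by auto
    have no_write: "(\<nexists>x y. Write a x y \<in> set I \<and> E x) \<longleftrightarrow> (\<forall>x y. Write a x y \<in> set I \<longrightarrow> \<not> E x)" for a E
      by blast
    have bex: "(\<exists>x\<in>X. E x) \<longleftrightarrow> \<not> (\<forall>x\<in>X. \<not> E x)" for X :: "nat set" and E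
      by blast
    show "row_cond c L (code_nth (command_code (e, I)) 1) s s' \<longleftrightarrow> step_row P (set I) ?t ?t'"
      unfolding row_cond_def step_row_def nth mem neg c(1) program_code_code_nth all_code_mem[OF less(4)]
        all_code_mem[OF less(2)] array_val_dec_state imp_conjL no_write bex
      by (rule refl)
  qed
  have "step_cond c L s s' \<longleftrightarrow> (\<exists>(e, I)\<in>set (commands P).
    bexp_holds c L s (code_nth (command_code (e, I)) 0) \<and> bool_cond c L (code_nth (command_code (e, I)) 1) s s' \<and>
    x_cond c L (code_nth (command_code (e, I)) 1) s s' \<and>
    y_cond c L (code_nth (command_code (e, I)) 1) s s' \<and> row_cond c L (code_nth (command_code (e, I)) 1) s s')"
    unfolding step_cond_def c(1) program_code_code_nth all_code_mem[OF less(5)] by auto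
  then show ?thesis
    unfolding symbolic_step_def using * by fast
qed

section \<open>Fixpoint formulas on bit masks\<close>

definition env_bound :: "nat \<Rightarrow> nat" where
  "env_bound c = prod_encode (c, state_bound c)"

definition env_update :: "nat \<Rightarrow> nat \<Rightarrow> nat \<Rightarrow> nat \<Rightarrow> nat" where
  "env_update c e h r = set_encode {t. t < env_bound c \<and>
    (code_fst t = h \<and> code_snd t \<in> set_decode r \<or> code_fst t \<noteq> h \<and> t \<in> set_decode e)}"

definition holds_in :: "nat \<Rightarrow> nat \<Rightarrow> nat \<Rightarrow> nat \<Rightarrow> bool" where
  "holds_in W f e s \<longleftrightarrow> prod_encode (f, prod_encode (e, s)) \<in> set_decode W"

text \<open>
  \<open>W\<close> is the mask of the triples (formula, environment, state) already known to hold; an environment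
  is the mask of the pairs (variable, state) that it makes true.
\<close>

definition mu_cond :: "nat \<Rightarrow> nat \<Rightarrow> nat \<Rightarrow> nat \<Rightarrow> nat \<Rightarrow> bool" where
  "mu_cond c W f e s \<longleftrightarrow> s < state_bound c \<and>
    (code_nth f 0 = 0 \<and> bool_val (dec_state (value_bound c) s) (code_nth f 1) \<or>
     code_nth f 0 = 1 \<and> \<not> bool_val (dec_state (value_bound c) s) (code_nth f 1) \<or>
     code_nth f 0 = 2 \<and> prod_encode (code_nth f 1, s) \<in> set_decode e \<or>
     code_nth f 0 = 3 \<and> (holds_in W (code_nth f 1) e s \<or> holds_in W (code_nth f 2) e s) \<or>
     code_nth f 0 = 4 \<and> holds_in W (code_nth f 1) e s \<and> holds_in W (code_nth f 2) e s \<or>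
     code_nth f 0 = 5 \<and> (\<exists>s'<state_bound c. step_cond c (value_bound c) s s' \<and> holds_in W (code_nth f 1) e s') \<or>
     code_nth f 0 = 6 \<and> (\<forall>s'<state_bound c. step_cond c (value_bound c) s s' \<longrightarrow> holds_in W (code_nth f 1) e s') \<or>
     code_nth f 0 = 7 \<and> (\<forall>r<2 ^ state_bound c. (\<forall>s'<state_bound c.
       s' \<in> set_decode r \<longleftrightarrow> holds_in W (code_nth f 2) (env_update c e (code_nth f 1) r) s') \<longrightarrow> s \<in> set_decode r) \<or>
     code_nth f 0 = 8 \<and> (\<exists>r<2 ^ state_bound c. (\<forall>s'<state_bound c.
       s' \<in> set_decode r \<longleftrightarrow> holds_in W (code_nth f 2) (env_update c e (code_nth f 1) r) s') \<and> s \<in> set_decode r))"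

text \<open>All environments are tabulated side by side, because a fixpoint operator consults its
  body in updated environments; environments are masks below \<open>2 ^ env_bound c\<close>.\<close>

definition mu_stage :: "nat \<Rightarrow> nat \<Rightarrow> nat" where
  "mu_stage c d = rec_nat 0 (\<lambda>_ W. set_encode {t.
    t < prod_encode (c, prod_encode (2 ^ env_bound c, state_bound c)) \<and>
    mu_cond c W (code_fst t) (code_fst (code_snd t)) (code_snd (code_snd t))}) d"

text \<open>The mask 0 is the empty environment, and \<open>c\<close> rounds suffice because the
  code of the formula is below \<open>c\<close>.\<close>

definition mc_check :: "nat \<Rightarrow> bool" where
  "mc_check c \<longleftrightarrow> (\<forall>s<state_bound c. bool_val (dec_state (value_bound c) s) (code_nth c 1) \<longrightarrow>
    holds_in (mu_stage c c) (code_nth c 2) 0 s)"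

definition env_of :: "nat \<Rightarrow> nat \<Rightarrow> nat \<Rightarrow> nat set" where
  "env_of c e h = {s. s < state_bound c \<and> prod_encode (h, s) \<in> set_decode e}"

lemma env_update_less: "env_update c e h r < 2 ^ env_bound c"
  unfolding env_update_def by (rule set_encode_less_power) auto

text \<open>The cutoff in \<open>env_update\<close> loses nothing: \<open>h < c\<close> and states
  below \<open>state_bound c\<close> give pairs below \<open>env_bound c\<close>.\<close>

lemma env_of_update:
  assumes "h < c" "e < 2 ^ env_bound c" "r < 2 ^ state_bound c"
  shows "env_of c (env_update c e h r) = (env_of c e)(h := set_decode r)"
proof
  fix g
  have r: "set_decode r \<subseteq> {..<state_bound c}" and e: "set_decode e \<subseteq> {..<env_bound c}"
    using assms(2,3) set_decode_less_power by blast+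
  show "env_of c (env_update c e h r) g = ((env_of c e)(h := set_decode r)) g"
    using r e prod_encode_less[OF assms(1), of _ "state_bound c"]
    by (auto simp: env_of_def env_update_def env_bound_def)
qed

lemma holds_in_mu_stage:
  assumes "f < c" "e < 2 ^ env_bound c" "s < state_bound c"
  shows "holds_in (mu_stage c (Suc d)) f e s \<longleftrightarrow> mu_cond c (mu_stage c d) f e s"
  using prod_encode_less[OF assms(1) prod_encode_less[OF assms(2,3)]]
  by (simp add: holds_in_def mu_stage_def)

text \<open>Turns the quantifier over sets of states in the fixpoint semantics into a bounded one
  over numbers.\<close>

lemma all_less_power_set:
  "(\<forall>r<2 ^ n. Q (set_decode r)) \<longleftrightarrow> (\<forall>A. A \<subseteq> {..<n} \<longrightarrow> Q A)"
proof
  assume *: "\<forall>r<2 ^ n. Q (set_decode r)"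
  show "\<forall>A. A \<subseteq> {..<n} \<longrightarrow> Q A"
  proof (intro allI impI)
    fix A :: "nat set" assume A: "A \<subseteq> {..<n}"
    then have "finite A" by (rule finite_subset) simp
    then show "Q A" using *[rule_format, OF set_encode_less_power[OF A]] by simp
  qed
qed (use set_decode_less_power in blast)

text \<open>As for boolean expressions, round \<open>d\<close> settles the formulas with code below
  \<open>d\<close>. The environment varies in the induction, since binders update it; the definition
  of the fixpoint operators is searched literally, over all sets of states.\<close>

lemma holds_in_iff_mu_sem:
  fixes \<phi> :: "(nat, nat) mu_formula"
  assumes c: "code_nth c 0 = program_code P" "program_code P < c" and "wf_program P"
  defines "S \<equiv> symbolic.symbolic_ts P (state_bound c) (dec_state (value_bound c))"
  shows "formula_code \<phi> < d \<Longrightarrow> formula_code \<phi> < c \<Longrightarrow> e < 2 ^ env_bound c \<Longrightarrow> s < state_bound c \<Longrightarrow>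
    holds_in (mu_stage c d) (formula_code \<phi>) e s \<longleftrightarrow> s \<in> mu_sem S \<phi> (env_of c e)"
proof -
  let ?M = "state_bound c" and ?L = "value_bound c"
  interpret symbolic P ?L ?M "dec_state ?L"
    by (rule symbolic_dec_state) fact+
  have S: "states S = {..<?M}" "s \<in> ext S b \<longleftrightarrow> s < ?M \<and> bool_val (dec_state ?L s) b"
    "s' \<in> succs S s \<longleftrightarrow> s' < ?M \<and> step_cond c ?L s s'" for s s' b
    by (simp_all add: S_def symbolic_ts_def step_cond_iff[OF c])
  have sem_sub: "mu_sem S \<phi> E \<subseteq> {..<?M}" if "\<And>h. E h \<subseteq> {..<?M}" for \<phi> :: "(nat, nat) mu_formula" and E
    by (rule mu_sem_subset[of S, unfolded S]) (use S that in auto)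
  have env: "env_of c e h \<subseteq> {..<?M}" for e h by (auto simp: env_of_def)
  have unfold: "holds_in (mu_stage c d) (formula_code \<phi>) e s \<longleftrightarrow> mu_cond c (mu_stage c (d - 1)) (formula_code \<phi>) e s"
    if "formula_code \<phi> < d" "formula_code \<phi> < c" "e < 2 ^ env_bound c" "s < ?M" for \<phi> d e s
    using holds_in_mu_stage[OF that(2-4), of "d - 1"] that(1) by simp
  have nth: "code_nth (list_encode [k, u]) 0 = k" "code_nth (list_encode [k, u]) (Suc 0) = u"
    "code_nth (list_encode [k, u, v]) 0 = k" "code_nth (list_encode [k, u, v]) (Suc 0) = u"
    "code_nth (list_encode [k, u, v]) 2 = v" for k u v
    by (simp_all add: code_nth_list_encode)
  have less: "u < list_encode [k, u]" "u < list_encode [k, u, v]" "v < list_encode [k, u, v]" for k u v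
    by (auto intro: member_less_list_encode)
  \<comment> \<open>Comparing bits below \<open>state_bound c\<close> amounts to set equality,
    because the mask and the semantics both lie in that range.\<close>
  have fixpoint: "(\<forall>s'<?M. s' \<in> set_decode r \<longleftrightarrow> holds_in (mu_stage c (d - 1)) (formula_code \<phi>) (env_update c e h r) s')
      \<longleftrightarrow> set_decode r = mu_sem S \<phi> ((env_of c e)(h := set_decode r))"
    if less: "r < 2 ^ ?M" "h < c" "e < 2 ^ env_bound c"
      and IH: "\<And>e s. e < 2 ^ env_bound c \<Longrightarrow> s < ?M \<Longrightarrow>
        holds_in (mu_stage c (d - 1)) (formula_code \<phi>) e s \<longleftrightarrow> s \<in> mu_sem S \<phi> (env_of c e)"
    for r h e d \<phi>
  proof -
    have r: "set_decode r \<subseteq> {..<?M}" using less(1) by (rule set_decode_less_power)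
    have "mu_sem S \<phi> ((env_of c e)(h := set_decode r)) \<subseteq> {..<?M}"
      by (rule sem_sub) (use r env in auto)
    moreover have "holds_in (mu_stage c (d - 1)) (formula_code \<phi>) (env_update c e h r) s' \<longleftrightarrow>
      s' \<in> mu_sem S \<phi> ((env_of c e)(h := set_decode r))" if "s' < ?M" for s'
      using IH[OF env_update_less that] env_of_update[OF less(2,3,1)] by simp
    ultimately show ?thesis using r by auto
  qed
  have "holds_in (mu_stage c d) (formula_code \<phi>) e s \<longleftrightarrow> s \<in> mu_sem S \<phi> (env_of c e)"
    if "formula_code \<phi> < d" "formula_code \<phi> < c" "e < 2 ^ env_bound c" "s < ?M" for \<phi> d e s
    using that
  proof (induction \<phi> arbitrary: d e s)
    case (Obs p)
    show ?case unfolding unfold[OF Obs] by (simp add: mu_cond_def nth S Obs)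
  next
    case (NegObs p)
    show ?case unfolding unfold[OF NegObs] by (simp add: mu_cond_def nth S NegObs)
  next
    case (FVar h)
    show ?case unfolding unfold[OF FVar] by (simp add: mu_cond_def nth FVar env_of_def)
  next
    case (Or \<phi> \<psi>)
    have IH: "holds_in (mu_stage c (d - 1)) (formula_code \<phi>) e s \<longleftrightarrow> s \<in> mu_sem S \<phi> (env_of c e)"
      "holds_in (mu_stage c (d - 1)) (formula_code \<psi>) e s \<longleftrightarrow> s \<in> mu_sem S \<psi> (env_of c e)"
      using Or.prems less(2,3)[of "formula_code \<phi>" 3 "formula_code \<psi>"] less(3)[of "formula_code \<psi>" 3 "formula_code \<phi>"]
      by (intro Or.IH; simp)+
    show ?case unfolding unfold[OF Or.prems] using Or.prems(4) IH by (simp add: mu_cond_def nth)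
  next
    case (And \<phi> \<psi>)
    have IH: "holds_in (mu_stage c (d - 1)) (formula_code \<phi>) e s \<longleftrightarrow> s \<in> mu_sem S \<phi> (env_of c e)"
      "holds_in (mu_stage c (d - 1)) (formula_code \<psi>) e s \<longleftrightarrow> s \<in> mu_sem S \<psi> (env_of c e)"
      using And.prems less(2,3)[of "formula_code \<phi>" 4 "formula_code \<psi>"] less(3)[of "formula_code \<psi>" 4 "formula_code \<phi>"]
      by (intro And.IH; simp)+
    show ?case unfolding unfold[OF And.prems] using And.prems(4) IH by (simp add: mu_cond_def nth)
  next
    case (ExNext \<phi>)
    have IH: "holds_in (mu_stage c (d - 1)) (formula_code \<phi>) e s' \<longleftrightarrow> s' \<in> mu_sem S \<phi> (env_of c e)"
      if "s' < ?M" for s'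
      using ExNext.prems less(1)[of "formula_code \<phi>" 5] that by (intro ExNext.IH; simp)
    show ?case unfolding unfold[OF ExNext.prems] using ExNext.prems(4) IH
      by (simp add: mu_cond_def nth S Bex_def cong: conj_cong)
  next
    case (AllNext \<phi>)
    have IH: "holds_in (mu_stage c (d - 1)) (formula_code \<phi>) e s' \<longleftrightarrow> s' \<in> mu_sem S \<phi> (env_of c e)"
      if "s' < ?M" for s'
      using AllNext.prems less(1)[of "formula_code \<phi>" 6] that by (intro AllNext.IH; simp)
    show ?case unfolding unfold[OF AllNext.prems] using AllNext.prems(4) IH
      by (simp add: mu_cond_def nth S Ball_def imp_conjL)
  next
    case (Mu h \<phi>)
    let ?F = "\<lambda>\<tau>. mu_sem S \<phi> ((env_of c e)(h := \<tau>))"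
    have h: "h < c" using Mu.prems(2) less(2)[of h 7 "formula_code \<phi>"] by simp
    have IH: "holds_in (mu_stage c (d - 1)) (formula_code \<phi>) e s \<longleftrightarrow> s \<in> mu_sem S \<phi> (env_of c e)"
      if "e < 2 ^ env_bound c" "s < ?M" for e s
      using Mu.prems(1,2) less(3)[of "formula_code \<phi>" 7 h] that by (intro Mu.IH; simp)
    have "holds_in (mu_stage c d) (formula_code (Mu h \<phi>)) e s \<longleftrightarrow>
      (\<forall>r<2 ^ ?M. set_decode r = ?F (set_decode r) \<longrightarrow> s \<in> set_decode r)"
      unfolding unfold[OF Mu.prems] using Mu.prems(4) fixpoint[OF _ h Mu.prems(3) IH]
      by (simp add: mu_cond_def nth)
    also have "\<dots> \<longleftrightarrow> (\<forall>\<tau>. \<tau> \<subseteq> {..<?M} \<longrightarrow> \<tau> = ?F \<tau> \<longrightarrow> s \<in> \<tau>)"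
      by (rule all_less_power_set)
    also have "\<dots> \<longleftrightarrow> s \<in> mu_sem S (Mu h \<phi>) (env_of c e)"
      unfolding mu_sem.simps S by blast
    finally show ?case .
  next
    case (Nu h \<phi>)
    let ?F = "\<lambda>\<tau>. mu_sem S \<phi> ((env_of c e)(h := \<tau>))"
    have h: "h < c" using Nu.prems(2) less(2)[of h 8 "formula_code \<phi>"] by simp
    have IH: "holds_in (mu_stage c (d - 1)) (formula_code \<phi>) e s \<longleftrightarrow> s \<in> mu_sem S \<phi> (env_of c e)"
      if "e < 2 ^ env_bound c" "s < ?M" for e s
      using Nu.prems(1,2) less(3)[of "formula_code \<phi>" 8 h] that by (intro Nu.IH; simp)
    have "holds_in (mu_stage c d) (formula_code (Nu h \<phi>)) e s \<longleftrightarrow>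
      (\<exists>r<2 ^ ?M. set_decode r = ?F (set_decode r) \<and> s \<in> set_decode r)"
      unfolding unfold[OF Nu.prems] using Nu.prems(4) fixpoint[OF _ h Nu.prems(3) IH]
      by (simp add: mu_cond_def nth cong: conj_cong)
    \<comment> \<open>The enumeration of subsets is stated for universal quantifiers, so the
      existential one passes through a double negation.\<close>
    also have "\<dots> \<longleftrightarrow> \<not> (\<forall>r<2 ^ ?M. \<not> (set_decode r = ?F (set_decode r) \<and> s \<in> set_decode r))"
      by blast
    also have "\<dots> \<longleftrightarrow> \<not> (\<forall>\<tau>. \<tau> \<subseteq> {..<?M} \<longrightarrow> \<not> (\<tau> = ?F \<tau> \<and> s \<in> \<tau>))"
      by (rule arg_cong[where f = Not, OF all_less_power_set])
    also have "\<dots> \<longleftrightarrow> s \<in> mu_sem S (Nu h \<phi>) (env_of c e)"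
      unfolding mu_sem.simps S by blast
    finally show ?case .
  qed
  then show "formula_code \<phi> < d \<Longrightarrow> formula_code \<phi> < c \<Longrightarrow> e < 2 ^ env_bound c \<Longrightarrow> s < ?M \<Longrightarrow>
    holds_in (mu_stage c d) (formula_code \<phi>) e s \<longleftrightarrow> s \<in> mu_sem S \<phi> (env_of c e)" .
qed

lemma mc_check_correct:
  assumes "infinite A" "infinite B" and i: "i \<in> mc_instances"
  shows "mc_check (mc_code i) \<longleftrightarrow> mc_holds A B i"
proof -
  obtain P b \<phi> where i': "i = (P, b, \<phi>)" by (cases i)
  with i have inst: "wf_program P" "b \<in> set (bool_vars P)" "closed_formula \<phi>"
    "formula_obs \<phi> \<subseteq> set (bool_vars P)"
    by (auto simp: mc_instances_def)
  define c where "c = mc_code i"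
  have c: "code_nth c 0 = program_code P" "code_nth c 1 = b" "code_nth c 2 = formula_code \<phi>"
    "program_code P < c" "formula_code \<phi> < c"
    by (auto simp: c_def mc_code_def i' code_nth_list_encode intro: member_less_list_encode)
  interpret symbolic P "value_bound c" "state_bound c" "dec_state (value_bound c)"
    by (rule symbolic_dec_state) fact+
  have "env_of c 0 = (\<lambda>_. {})" by (auto simp: env_of_def)
  then have "holds_in (mu_stage c c) (formula_code \<phi>) 0 s \<longleftrightarrow> s \<in> mu_sem symbolic_ts \<phi> (\<lambda>_. {})"
    if "s < state_bound c" for s
    using holds_in_iff_mu_sem[OF c(1,4) inst(1) c(5,5) _ that, of 0] by simp
  then have "mc_check c \<longleftrightarrow> mc_holds A B (P, b, \<phi>)"
    unfolding mc_check_def c mc_holds_symbolic[OF assms(1,2) inst(2-4)] by simp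
  then show ?thesis by (simp add: c_def i')
qed

section \<open>Computability of the check\<close>

lemma computable_digit [computable_intros]:
  "computable n f \<Longrightarrow> computable n g \<Longrightarrow> computable n h \<Longrightarrow> computable n (\<lambda>xs. digit (f xs) (g xs) (h xs))"
  unfolding digit_def by (intro computable_intros computable_leaves)

lemma decidable_bool_val [computable_intros]:
  "computable n f \<Longrightarrow> computable n g \<Longrightarrow> computable n h \<Longrightarrow> decidable n (\<lambda>xs. bool_val (dec_state (f xs) (g xs)) (h xs))"
  by (simp add: dec_state_def) (intro computable_intros computable_leaves)

lemma computable_x_val [computable_intros]:
  "computable n f \<Longrightarrow> computable n g \<Longrightarrow> computable n h \<Longrightarrow> computable n (\<lambda>xs. x_val (dec_state (f xs) (g xs)) (h xs))"
  by (simp add: dec_state_def) (intro computable_intros computable_leaves)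

lemma computable_y_val [computable_intros]:
  "computable n f \<Longrightarrow> computable n g \<Longrightarrow> computable n h \<Longrightarrow> computable n (\<lambda>xs. y_val (dec_state (f xs) (g xs)) (h xs))"
  by (simp add: dec_state_def) (intro computable_intros computable_leaves)

lemma computable_array_val [computable_intros]:
  "computable n f \<Longrightarrow> computable n g \<Longrightarrow> computable n h \<Longrightarrow> computable n k \<Longrightarrow>
    computable n (\<lambda>xs. the (array_val (dec_state (f xs) (g xs)) (h xs) (k xs)))"
  by (simp add: dec_state_def) (intro computable_intros computable_leaves)

lemma computable_value_bound [computable_intros]: "computable n f \<Longrightarrow> computable n (\<lambda>xs. value_bound (f xs))"
  unfolding value_bound_def by (intro computable_intros computable_leaves)

lemma computable_state_bound [computable_intros]: "computable n f \<Longrightarrow> computable n (\<lambda>xs. state_bound (f xs))"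
  unfolding state_bound_def by (intro computable_intros computable_leaves)

lemma computable_env_bound [computable_intros]: "computable n f \<Longrightarrow> computable n (\<lambda>xs. env_bound (f xs))"
  unfolding env_bound_def by (intro computable_intros computable_leaves)

lemma decidable_bexp_cond [computable_intros]:
  "computable n f \<Longrightarrow> computable n g \<Longrightarrow> computable n h \<Longrightarrow> computable n k \<Longrightarrow>
    decidable n (\<lambda>xs. bexp_cond (f xs) (g xs) (h xs) (k xs))"
  unfolding bexp_cond_def by (intro computable_intros computable_leaves)

lemma decidable_bexp_holds [computable_intros]:
  "computable n f \<Longrightarrow> computable n g \<Longrightarrow> computable n h \<Longrightarrow> computable n k \<Longrightarrow>
    decidable n (\<lambda>xs. bexp_holds (f xs) (g xs) (h xs) (k xs))"
  unfolding bexp_holds_def bexp_stage_def by (intro computable_intros computable_leaves)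

text \<open>The assignment codes tested here come from lists of fixed length, which unfold into
  successors and pairings.\<close>

lemma decidable_bool_cond [computable_intros]:
  "computable n f \<Longrightarrow> computable n g \<Longrightarrow> computable n h \<Longrightarrow> computable n k \<Longrightarrow> computable n l \<Longrightarrow>
    decidable n (\<lambda>xs. bool_cond (f xs) (g xs) (h xs) (k xs) (l xs))"
  unfolding bool_cond_def list_encode.simps by (intro computable_intros computable_leaves)

lemma decidable_x_cond [computable_intros]:
  "computable n f \<Longrightarrow> computable n g \<Longrightarrow> computable n h \<Longrightarrow> computable n k \<Longrightarrow> computable n l \<Longrightarrow>
    decidable n (\<lambda>xs. x_cond (f xs) (g xs) (h xs) (k xs) (l xs))"
  unfolding x_cond_def list_encode.simps by (intro computable_intros computable_leaves)

lemma decidable_y_cond [computable_intros]: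
  "computable n f \<Longrightarrow> computable n g \<Longrightarrow> computable n h \<Longrightarrow> computable n k \<Longrightarrow> computable n l \<Longrightarrow>
    decidable n (\<lambda>xs. y_cond (f xs) (g xs) (h xs) (k xs) (l xs))"
  unfolding y_cond_def list_encode.simps by (intro computable_intros computable_leaves)

lemma decidable_row_cond [computable_intros]:
  "computable n f \<Longrightarrow> computable n g \<Longrightarrow> computable n h \<Longrightarrow> computable n k \<Longrightarrow> computable n l \<Longrightarrow>
    decidable n (\<lambda>xs. row_cond (f xs) (g xs) (h xs) (k xs) (l xs))"
  unfolding row_cond_def list_encode.simps by (intro computable_intros computable_leaves)

lemma decidable_step_cond [computable_intros]:
  "computable n f \<Longrightarrow> computable n g \<Longrightarrow> computable n h \<Longrightarrow> computable n k \<Longrightarrow>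
    decidable n (\<lambda>xs. step_cond (f xs) (g xs) (h xs) (k xs))"
  unfolding step_cond_def by (intro computable_intros computable_leaves)

lemma computable_env_update [computable_intros]:
  "computable n f \<Longrightarrow> computable n g \<Longrightarrow> computable n h \<Longrightarrow> computable n k \<Longrightarrow>
    computable n (\<lambda>xs. env_update (f xs) (g xs) (h xs) (k xs))"
  unfolding env_update_def by (intro computable_intros computable_leaves)

lemma decidable_holds_in [computable_intros]:
  "computable n f \<Longrightarrow> computable n g \<Longrightarrow> computable n h \<Longrightarrow> computable n k \<Longrightarrow>
    decidable n (\<lambda>xs. holds_in (f xs) (g xs) (h xs) (k xs))"
  unfolding holds_in_def by (intro computable_intros computable_leaves)

lemma decidable_mu_cond [computable_intros]:
  "computable n f \<Longrightarrow> computable n g \<Longrightarrow> computable n h \<Longrightarrow> computable n k \<Longrightarrow> computable n l \<Longrightarrow>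
    decidable n (\<lambda>xs. mu_cond (f xs) (g xs) (h xs) (k xs) (l xs))"
  unfolding mu_cond_def by (intro computable_intros computable_leaves)

lemma decidable_mc_check:
  "computable n f \<Longrightarrow> decidable n (\<lambda>xs. mc_check (f xs))"
  unfolding mc_check_def mu_stage_def by (intro computable_intros computable_leaves)

theorem theorem1:
  fixes A :: "'a set" and B :: "'b set" and A' :: "'c set" and B' :: "'d set"
  assumes "infinite A" and "infinite B" and "infinite A'" and "infinite B'"
  shows "decidable_on mc_code mc_instances (mc_holds A B) \<and>
    (\<forall>i\<in>mc_instances. mc_holds A B i \<longleftrightarrow> mc_holds A' B' i)"
proof
  have "decidable (Suc 0) (\<lambda>xs. mc_check (hd xs))"
    by (rule decidable_mc_check[OF computable_hd])
  then obtain f where "recursive (Suc 0) f"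
    "\<And>xs. length xs = Suc 0 \<Longrightarrow> f xs = (if mc_check (hd xs) then 1 else 0)"
    unfolding decidable_def computable_def by blast
  then show "decidable_on mc_code mc_instances (mc_holds A B)"
    unfolding decidable_on_def by (intro exI[of _ f]) (simp add: mc_check_correct[OF assms(1,2)])
  \<comment> \<open>The same carrier-free check answers for both pairs of carriers.\<close>
  show "\<forall>i\<in>mc_instances. mc_holds A B i \<longleftrightarrow> mc_holds A' B' i"
    using mc_check_correct[OF assms(1,2)] mc_check_correct[OF assms(3,4)] by blast
qed

end
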